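(* Let $n,k$ be positive integers, let $S\subseteq\{0,1,\dots,k-1\}$ be nonempty with $s:=\min(S)$, and let $n\geq 2k-s$. Then \[Z(J_S(n,k))\le Z_t(J_S(n,k))\le Z_c(J_S(n,k))\le\binom{n}{k}-\binom{n-2(k-s)}{s}.\] If $S=\{s,s+1,\dots,k-1\}$, then equality holds throughout.
   Context: For $S\subseteq\{0,1,\dots,k-1\}$, the generalized Johnson graph $J_S(n,k)$ is the simple graph whose vertices are the $k$-element subsets of $\{1,\dots,n\}$, two distinct vertices being adjacent if and only if the size of their intersection lies in $S$. Zero forcing on a graph $G$: start with a set of black vertices, all others white; repeatedly, if a black vertex $v$ has exactly one white neighbor $w$, color $w$ black. A set of initially black vertices is a zero forcing set if this process eventually colors all vertices black. $Z(G)$ is the minimum size of a zero forcing set; $Z_t(G)$ is the minimum size of a zero forcing set $B$ such that the induced subgraph $G[B]$ has no isolated vertices; $Z_c(G)$ is the minimum size of a zero forcing set $B$ such that $G[B]$ is connected.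
   Formalization: The case S={0}, n=2k is excluded: there the graph is a perfect matching, so Z_t equals binom(2k,k), which exceeds the claimed upper bound binom(2k,k)-1, and the stated chain of inequalities is false. *)

theory Defs
  imports "Graph_Theory.Graph_Theory" "HOL-Library.Extended_Nat"
begin

text \<open>
  Simple graphs are symmetric loop-free digraphs, as in the locale \<^locale>\<open>pair_graph\<close>.
\<close>

definition gen_johnson_graph :: "nat set \<Rightarrow> nat \<Rightarrow> nat \<Rightarrow> nat set pair_pre_digraph" where
  "gen_johnson_graph S n k =
     \<lparr> pverts = {A. A \<subseteq> {1..n} \<and> card A = k},
       parcs = {(A, B). A \<subseteq> {1..n} \<and> card A = k \<and> B \<subseteq> {1..n} \<and> card B = k \<and>
                        A \<noteq> B \<and> card (A \<inter> B) \<in> S} \<rparr>"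

lemma pair_graph_gen_johnson_graph: "pair_graph (gen_johnson_graph S n k)"
proof -
  have fin: "finite {A. A \<subseteq> {1..n} \<and> card A = k}"
    by (rule finite_subset[of _ "Pow {1..n}"]) auto
  have fin_arcs: "finite {(A, B). A \<subseteq> {1..n} \<and> card A = k \<and> B \<subseteq> {1..n} \<and> card B = k \<and>
                        A \<noteq> B \<and> card (A \<inter> B) \<in> S}"
    by (rule finite_subset[OF _ finite_cartesian_product[OF fin fin]]) auto
  show ?thesis
  proof unfold_locales
    show "finite (pverts (gen_johnson_graph S n k))"
      using fin by (simp add: gen_johnson_graph_def)
    show "finite (parcs (gen_johnson_graph S n k))"
      using fin_arcs by (simp add: gen_johnson_graph_def)
    show "symmetric (with_proj (gen_johnson_graph S n k))"
      unfolding symmetric_def sym_def by (simp add: gen_johnson_graph_def Int_commute) blast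
  qed (simp_all add: gen_johnson_graph_def split: prod.splits)
qed

definition force_step :: "('a, 'b) pre_digraph \<Rightarrow> 'a set \<Rightarrow> 'a set \<Rightarrow> bool" where
  "force_step G B B' \<longleftrightarrow>
     (\<exists>v\<in>B. \<exists>w. {u \<in> verts G - B. v \<rightarrow>\<^bsub>G\<^esub> u} = {w} \<and> B' = insert w B)"

definition zero_forcing_set :: "('a, 'b) pre_digraph \<Rightarrow> 'a set \<Rightarrow> bool" where
  "zero_forcing_set G B \<longleftrightarrow> B \<subseteq> verts G \<and> (force_step G)\<^sup>*\<^sup>* B (verts G)"

definition no_isolated_vertices :: "('a, 'b) pre_digraph \<Rightarrow> bool" where
  "no_isolated_vertices G \<longleftrightarrow> (\<forall>v\<in>verts G. \<exists>w\<in>verts G. v \<rightarrow>\<^bsub>G\<^esub> w)"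

text \<open>
  The minima are taken in \<^typ>\<open>enat\<close>, so that the minimum over an empty family is \<open>\<infinity>\<close>.
  These parameters are meant for finite graphs (\<^const>\<open>card\<close> is 0 on infinite sets).
\<close>

definition zero_forcing_number :: "('a, 'b) pre_digraph \<Rightarrow> enat" where
  "zero_forcing_number G = (INF B \<in> {B. zero_forcing_set G B}. enat (card B))"

definition total_forcing_number :: "('a, 'b) pre_digraph \<Rightarrow> enat" where
  "total_forcing_number G =
     (INF B \<in> {B. zero_forcing_set G B \<and> no_isolated_vertices (G \<restriction> B)}. enat (card B))"

definition connected_forcing_number :: "('a, 'b) pre_digraph \<Rightarrow> enat" where
  "connected_forcing_number G =
     (INF B \<in> {B. zero_forcing_set G B \<and> Digraph_Component.connected (G \<restriction> B)}. enat (card B))"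

text \<open>
  For \<open>S = {0}\<close> and \<open>n = 2k\<close> the graph is a perfect matching (every set is adjacent only to its
  complement). There the only zero forcing set without isolated vertices is the whole vertex set,
  so the total forcing number exceeds \<open>(2k choose k) - 1\<close>, which is the value of
  \<open>(n choose k) - (n - 2(k - s) choose s)\<close>.
\<close>

lemma dominates_induce_subgraph:
  "v \<rightarrow>\<^bsub>G \<restriction> B\<^esub> w \<longleftrightarrow> v \<in> B \<and> w \<in> B \<and> v \<rightarrow>\<^bsub>G\<^esub> w"
  unfolding arcs_ends_conv induce_subgraph_def by (simp add: image_iff) blast

lemma perfect_matching_adj:
  assumes "A \<rightarrow>\<^bsub>with_proj (gen_johnson_graph {0} (2 * k) k)\<^esub> B"
  shows "B = {1..2 * k} - A" and "A = {1..2 * k} - B"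
proof -
  have *: "A \<subseteq> {1..2 * k}" "card A = k" "B \<subseteq> {1..2 * k}" "card B = k" "card (A \<inter> B) = 0"
    using assms by (auto simp: gen_johnson_graph_def)
  have fin: "finite A" "finite B"
    using * finite_subset by blast+
  have disj: "A \<inter> B = {}"
    using * fin by auto
  have "card (A \<union> B) = card {1..2 * k}"
    using card_Un_disjoint[OF fin disj] * by simp
  hence "A \<union> B = {1..2 * k}"
    using * by (intro card_subset_eq) auto
  thus "B = {1..2 * k} - A" "A = {1..2 * k} - B"
    using disj by auto
qed

lemma perfect_matching_total_forcing_set:
  fixes k :: nat
  defines "G \<equiv> with_proj (gen_johnson_graph {0} (2 * k) k)"
  assumes zf: "zero_forcing_set G B" and iso: "no_isolated_vertices (G \<restriction> B)"
  shows "B = verts G"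
proof -
  have "\<not> force_step G B B'" for B'
  proof
    assume "force_step G B B'"
    then obtain v w where v: "v \<in> B" "{u \<in> verts G - B. v \<rightarrow>\<^bsub>G\<^esub> u} = {w}"
      by (auto simp: force_step_def)
    hence w: "w \<notin> B" "v \<rightarrow>\<^bsub>G\<^esub> w"
      by blast+
    obtain u where u: "u \<in> B" "v \<rightarrow>\<^bsub>G\<^esub> u"
      using iso v(1) unfolding no_isolated_vertices_def dominates_induce_subgraph by auto
    have "u = w"
      using perfect_matching_adj(1) w(2) u(2) unfolding G_def by metis
    with u(1) w(1) show False
      by simp
  qed
  moreover have "(force_step G)\<^sup>*\<^sup>* B (verts G)"
    using zf by (simp add: zero_forcing_set_def)
  ultimately show ?thesis
    by (meson converse_rtranclpE)
qed

lemma perfect_matching_exceeds_bound: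
  assumes "k > 0"
  shows "total_forcing_number (with_proj (gen_johnson_graph {0} (2 * k) k)) >
           enat ((2 * k choose k) - (2 * k - 2 * (k - 0) choose 0))"
proof -
  let ?G = "with_proj (gen_johnson_graph {0} (2 * k) k)"
  have "card (verts ?G) = (2 * k choose k)"
    using n_subsets[of "{1..2 * k}" k] by (simp add: gen_johnson_graph_def)
  hence "enat (2 * k choose k) \<le> total_forcing_number ?G"
    unfolding total_forcing_number_def
    by (intro INF_greatest) (auto dest!: perfect_matching_total_forcing_set)
  moreover have "(2 * k choose k) - 1 < (2 * k choose k)"
    by (simp add: zero_less_binomial)
  ultimately show ?thesis
    using order_less_le_trans[of "enat ((2 * k choose k) - 1)" "enat (2 * k choose k)"] by simp
qed

end

theory Submission
  imports Defs "Jordan_Normal_Form.Determinant"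
begin

text \<open>
  Put \<open>t = k - s\<close>, \<open>N = n - 2 * t\<close> and \<open>U = {1..n}\<close>.

  Lower bound. A forcing process gives pairs \<open>(v\<^sub>i, w\<^sub>i)\<close> of \<open>k\<close>-sets with
  \<open>card (v\<^sub>i \<inter> w\<^sub>i) \<ge> s\<close> and \<open>card (v\<^sub>i \<inter> w\<^sub>j) < s\<close> for \<open>j > i\<close>. Let \<open>F\<^sub>j\<close> and \<open>G\<^sub>i\<close> be the monic
  polynomials with root sets \<open>U - w\<^sub>j\<close> and \<open>v\<^sub>i\<close>. The \<open>N\<close> polynomials \<open>F\<^sub>j X\<^sup>a\<close> (\<open>a < s\<close>) and
  \<open>G\<^sub>i X\<^sup>b\<close> (\<open>b < N - s\<close>) are linearly dependent iff \<open>card (v\<^sub>i \<inter> w\<^sub>j) < s\<close>, as in the theory of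
  subresultants. Evaluating them at \<open>N\<close> points in general position yields determinants \<open>D\<^sub>i\<^sub>j\<close>
  that vanish for \<open>j > i\<close> but not for \<open>j = i\<close>. Expanding \<open>D\<^sub>i\<^sub>j\<close> by the \<open>s\<close> rows that are taken from
  the columns of \<open>F\<^sub>j\<close> shows that the matrix \<open>D\<close> has rank at most \<open>N choose s\<close>.

  Upper bound. Fix disjoint \<open>t\<close>-sets \<open>X\<close> and \<open>Y\<close> and leave exactly the sets \<open>X \<union> T\<close> with
  \<open>T \<subseteq> U - X - Y\<close>, \<open>card T = s\<close> white; then \<open>Y \<union> T\<close> forces \<open>X \<union> T\<close>. For a fixed \<open>y \<in> Y\<close> all sets
  containing \<open>y\<close> are black, and two black sets that differ by one swap have a common neighbour that
  contains \<open>y\<close>, except when \<open>S = {0}\<close>, or \<open>S = {1}\<close> and \<open>n = 2 * k - 1\<close>. In these cases there is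
  only one white vertex, and the swaps that it obstructs can be replaced by three others.
\<close>

section \<open>A skew set-pair inequality with threshold\<close>

text \<open>Gaussian elimination: with a pivot \<open>i\<close>, equation \<open>t\<close> is solved
  for the unknown \<open>a i\<close>, and the other equations are left with one unknown
  less.\<close>

lemma exists_nontrivial_linear_relation:
  fixes f :: "'t \<Rightarrow> 'j \<Rightarrow> 'a::field"
  assumes "finite T" "finite J" "card T < card J"
  shows "\<exists>a. (\<exists>j\<in>J. a j \<noteq> 0) \<and> (\<forall>t\<in>T. (\<Sum>j\<in>J. a j * f t j) = 0)"
  using assms
proof (induction T arbitrary: J f rule: finite_induct)
  case empty
  then obtain j where "j \<in> J"
    by fastforce
  then show ?case
    by (intro exI[of _ "\<lambda>_. 1"]) auto
next
  case (insert t T)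
  show ?case
  proof (cases "\<forall>j\<in>J. f t j = 0")
    case True
    obtain a where "\<exists>j\<in>J. a j \<noteq> 0" "\<forall>t\<in>T. (\<Sum>j\<in>J. a j * f t j) = 0"
      using insert.IH[of J f] insert.prems insert.hyps by auto
    with True show ?thesis
      by (intro exI[of _ a]) auto
  next
    case False
    then obtain i where i: "i \<in> J" "f t i \<noteq> 0"
      by blast
    \<comment> \<open>The system after elimination of the unknown with index \<open>i\<close> by
      means of equation \<open>t\<close>.\<close>
    define g where "g u j = f u j - f u i * f t j / f t i" for u j
    have "card T < card (J - {i})"
      using insert i by simp
    then obtain a where a: "\<exists>j\<in>J - {i}. a j \<noteq> 0" "\<forall>u\<in>T. (\<Sum>j\<in>J - {i}. a j * g u j) = 0"
      using insert.IH[of "J - {i}" g] insert.prems by auto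
    \<comment> \<open>Back substitution: the value at \<open>i\<close> is chosen such that equation
      \<open>t\<close> holds.\<close>
    define b where "b = a(i := - (\<Sum>j\<in>J - {i}. a j * f t j) / f t i)"
    have sum_b: "(\<Sum>j\<in>J. b j * f u j) = (\<Sum>j\<in>J - {i}. a j * g u j)" for u
    proof -
      have "(\<Sum>j\<in>J. b j * f u j) = b i * f u i + (\<Sum>j\<in>J - {i}. b j * f u j)"
        using insert.prems i by (simp add: sum.remove)
      also have "(\<Sum>j\<in>J - {i}. b j * f u j) = (\<Sum>j\<in>J - {i}. a j * f u j)"
        by (intro sum.cong) (auto simp: b_def)
      also have "b i * f u i = - (\<Sum>j\<in>J - {i}. a j * (f u i * f t j / f t i))"
        by (simp add: b_def sum_distrib_left sum_distrib_right sum_divide_distrib ac_simps)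
      finally show ?thesis
        by (simp add: g_def algebra_simps sum_subtractf)
    qed
    have "(\<Sum>j\<in>J - {i}. a j * g t j) = 0"
      using i by (simp add: g_def)
    then have "\<forall>u\<in>insert t T. (\<Sum>j\<in>J. b j * f u j) = 0"
      using a sum_b by auto
    moreover have "\<exists>j\<in>J. b j \<noteq> 0"
      using a by (auto simp: b_def)
    ultimately show ?thesis
      by blast
  qed
qed

text \<open>The points are chosen one at a time. As a function of the newest point each determinant
  is a polynomial, by Laplace expansion along the last row. The previous determinant is its
  coefficient at \<open>p i N\<close>, so independence makes it nonzero, and the finitely many roots
  for all \<open>i\<close> together can be avoided.\<close>

lemma exists_common_evaluation_points:
  fixes p :: "'i \<Rightarrow> nat \<Rightarrow> 'a::field_char_0 poly"
  assumes "finite I"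
    and "\<And>i c. i \<in> I \<Longrightarrow> (\<Sum>j<N. smult (c j) (p i j)) = 0 \<Longrightarrow> \<forall>j<N. c j = 0"
  shows "\<exists>\<beta>. \<forall>i\<in>I. det (mat N N (\<lambda>(r, j). poly (p i j) (\<beta> r))) \<noteq> 0"
  using assms(2)
proof (induction N)
  case 0
  show ?case
    by (simp add: det_dim_zero)
next
  case (Suc N)
  have "\<forall>j<N. c j = 0" if "i \<in> I" "(\<Sum>j<N. smult (c j) (p i j)) = 0" for i c
    using Suc.prems[OF that(1), of "c(N := 0)"] that(2) by (auto simp: less_Suc_eq)
  then obtain \<beta> where \<beta>: "\<forall>i\<in>I. det (mat N N (\<lambda>(r, j). poly (p i j) (\<beta> r))) \<noteq> 0"
    using Suc.IH by blast
  define A where "A i x = mat (Suc N) (Suc N) (\<lambda>(r, j). poly (p i j) ((\<beta>(N := x)) r))" for i x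
  \<comment> \<open>Cofactors along the last row ignore that row, so 0 stands for any last
    point.\<close>
  define C where "C i j = cofactor (A i 0) N j" for i j
  define q where "q i = (\<Sum>j<Suc N. smult (C i j) (p i j))" for i
  have cofactor_A: "cofactor (A i x) N j = C i j" for i x j
    by (auto simp: C_def cofactor_def mat_delete_def A_def intro!: arg_cong[where f = det] eq_matI)
  have det_A: "det (A i x) = poly (q i) x" for i x
  proof -
    have "A i x \<in> carrier_mat (Suc N) (Suc N)"
      by (simp add: A_def)
    then have "det (A i x) = (\<Sum>j<Suc N. A i x $$ (N, j) * cofactor (A i x) N j)"
      by (intro laplace_expansion_row) auto
    also have "\<dots> = (\<Sum>j<Suc N. poly (p i j) x * C i j)"
      unfolding cofactor_A by (intro sum.cong refl) (simp add: A_def)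
    finally show ?thesis
      by (simp add: q_def poly_sum ac_simps)
  qed
  have "q i \<noteq> 0" if "i \<in> I" for i
  proof
    assume "q i = 0"
    then have "C i N = 0"
      using Suc.prems[OF that, of "C i"] unfolding q_def by blast
    then have "det (mat_delete (A i 0) N N) = 0"
      by (simp add: C_def cofactor_def)
    moreover have "mat_delete (A i 0) N N = mat N N (\<lambda>(r, j). poly (p i j) (\<beta> r))"
      by (auto simp: mat_delete_def A_def intro!: eq_matI)
    ultimately show False
      using \<beta> that by simp
  qed
  then have "finite (\<Union>i\<in>I. {x. poly (q i) x = 0})"
    using assms(1) by (auto intro: poly_roots_finite)
  then obtain x where "x \<notin> (\<Union>i\<in>I. {x. poly (q i) x = 0})"
    using ex_new_if_finite infinite_UNIV_char_0 by blast
  then have "\<forall>i\<in>I. det (A i x) \<noteq> 0"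
    using det_A by auto
  then show ?case
    unfolding A_def by blast
qed

section \<open>Sylvester-type matrices evaluated at points\<close>

definition sylvester_block :: "'a::comm_ring_1 poly \<Rightarrow> 'a poly \<Rightarrow> nat \<Rightarrow> nat \<Rightarrow> 'a poly" where
  "sylvester_block F G s j = (if j < s then F * monom 1 j else G * monom 1 (j - s))"

text \<open>Rows are evaluation points instead of coefficient positions. Each entry is thus a value
  of \<open>F\<close> or of \<open>G\<close> times a power of the point, which makes the expansion
  below possible.\<close>

definition sylvester_mat ::
    "nat \<Rightarrow> nat \<Rightarrow> (nat \<Rightarrow> 'a::comm_ring_1) \<Rightarrow> 'a poly \<Rightarrow> 'a poly \<Rightarrow> 'a mat" where
  "sylvester_mat N s \<beta> F G = mat N N (\<lambda>(r, j). poly (sylvester_block F G s j) (\<beta> r))"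

text \<open>
  In the Leibniz formula, a permutation contributes \<open>F\<close> exactly in the rows that it maps below \<open>s\<close>;
  grouping the permutations by this set of rows separates \<open>F\<close> from \<open>G\<close>.
\<close>

lemma det_sylvester_mat_expansion:
  fixes \<beta> :: "nat \<Rightarrow> 'a::comm_ring_1"
  assumes "s \<le> N"
  shows "\<exists>c. \<forall>F G. det (sylvester_mat N s \<beta> F G) =
           (\<Sum>T | T \<subseteq> {0..<N} \<and> card T = s.
              c T * (\<Prod>r\<in>T. poly F (\<beta> r)) * (\<Prod>r\<in>{0..<N} - T. poly G (\<beta> r)))"
proof -
  define P where "P = {\<pi>. \<pi> permutes {0..<N}}"
  define R where "R \<pi> = {r \<in> {0..<N}. \<pi> r < s}" for \<pi> :: "nat \<Rightarrow> nat"
  \<comment> \<open>Sign and powers of the points: the part of a Leibniz summand that depends on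
    neither \<open>F\<close> nor \<open>G\<close>.\<close>
  define e where "e \<pi> = (signof \<pi> * (\<Prod>r\<in>{0..<N}. \<beta> r ^ (if \<pi> r < s then \<pi> r else \<pi> r - s)) :: 'a)"
    for \<pi>
  define \<T> where "\<T> = {T. T \<subseteq> {0..<N} \<and> card T = s}"
  have finP: "finite P" and fin\<T>: "finite \<T>"
    by (auto simp: P_def \<T>_def finite_permutations)
  have R_in: "R \<pi> \<in> \<T>" if "\<pi> \<in> P" for \<pi>
  proof -
    have \<pi>: "\<pi> permutes {0..<N}"
      using that by (simp add: P_def)
    have "\<pi> ` R \<pi> = {0..<s}"
    proof (intro equalityI subsetI)
      fix x assume "x \<in> {0..<s}"
      then have "x \<in> \<pi> ` {0..<N}"
        using permutes_image[OF \<pi>] assms by auto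
      then show "x \<in> \<pi> ` R \<pi>"
        using \<open>x \<in> {0..<s}\<close> by (auto simp: R_def)
    qed (auto simp: R_def)
    then have "card (R \<pi>) = s"
      using card_image[OF inj_on_subset[OF permutes_inj[OF \<pi>] subset_UNIV], of "R \<pi>"] by simp
    then show ?thesis
      by (auto simp: \<T>_def R_def)
  qed
  have "det (sylvester_mat N s \<beta> F G) =
          (\<Sum>T\<in>\<T>. (\<Sum>\<pi> | \<pi> \<in> P \<and> R \<pi> = T. e \<pi>) *
             (\<Prod>r\<in>T. poly F (\<beta> r)) * (\<Prod>r\<in>{0..<N} - T. poly G (\<beta> r)))" for F G
  proof -
    have "det (sylvester_mat N s \<beta> F G) = (\<Sum>\<pi>\<in>P. signof \<pi> *
            (\<Prod>r = 0..<N. sylvester_mat N s \<beta> F G $$ (r, \<pi> r)))"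
      unfolding P_def by (rule det_def') (simp add: sylvester_mat_def)
    also have "\<dots> = (\<Sum>\<pi>\<in>P. e \<pi> *
                 (\<Prod>r\<in>R \<pi>. poly F (\<beta> r)) * (\<Prod>r\<in>{0..<N} - R \<pi>. poly G (\<beta> r)))"
    proof (intro sum.cong refl)
      fix \<pi> assume "\<pi> \<in> P"
      then have \<pi>: "\<pi> permutes {0..<N}"
        by (simp add: P_def)
      have "(\<Prod>r = 0..<N. sylvester_mat N s \<beta> F G $$ (r, \<pi> r)) =
              (\<Prod>r = 0..<N. (if r \<in> R \<pi> then poly F (\<beta> r) else poly G (\<beta> r)) *
                 \<beta> r ^ (if \<pi> r < s then \<pi> r else \<pi> r - s))"
        using permutes_in_image[OF \<pi>]
        by (intro prod.cong refl)
           (auto simp: sylvester_mat_def sylvester_block_def R_def poly_monom)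
      also have "\<dots> = (\<Prod>r = 0..<N. if r \<in> R \<pi> then poly F (\<beta> r) else poly G (\<beta> r)) *
                      (\<Prod>r = 0..<N. \<beta> r ^ (if \<pi> r < s then \<pi> r else \<pi> r - s))"
        by (rule prod.distrib)
      also have "(\<Prod>r = 0..<N. if r \<in> R \<pi> then poly F (\<beta> r) else poly G (\<beta> r)) =
                   (\<Prod>r\<in>R \<pi>. poly F (\<beta> r)) * (\<Prod>r\<in>{0..<N} - R \<pi>. poly G (\<beta> r))"
        by (subst prod.If_cases) (auto simp: R_def Diff_eq intro!: arg_cong2[where f = "(*)"] prod.cong)
      finally show "signof \<pi> * (\<Prod>r = 0..<N. sylvester_mat N s \<beta> F G $$ (r, \<pi> r)) =
          e \<pi> * (\<Prod>r\<in>R \<pi>. poly F (\<beta> r)) * (\<Prod>r\<in>{0..<N} - R \<pi>. poly G (\<beta> r))"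
        by (simp add: e_def ac_simps)
    qed
    also have "\<dots> = (\<Sum>T\<in>\<T>. \<Sum>\<pi> | \<pi> \<in> P \<and> R \<pi> = T. e \<pi> *
                 (\<Prod>r\<in>R \<pi>. poly F (\<beta> r)) * (\<Prod>r\<in>{0..<N} - R \<pi>. poly G (\<beta> r)))"
      using R_in by (intro sum.group[symmetric] finP fin\<T>) auto
    also have "\<dots> = (\<Sum>T\<in>\<T>. (\<Sum>\<pi> | \<pi> \<in> P \<and> R \<pi> = T. e \<pi>) *
             (\<Prod>r\<in>T. poly F (\<beta> r)) * (\<Prod>r\<in>{0..<N} - T. poly G (\<beta> r)))"
      by (intro sum.cong refl) (simp add: sum_distrib_right)
    finally show ?thesis .
  qed
  then show ?thesis
    unfolding \<T>_def by (intro exI[of _ "\<lambda>T. \<Sum>\<pi> | \<pi> \<in> P \<and> R \<pi> = T. e \<pi>"]) simp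
qed

text \<open>Cutting the vector \<open>c\<close> at \<open>s\<close> gives the coefficients of a
  polynomial \<open>g\<close> of degree below \<open>s\<close> and of a polynomial \<open>h\<close>
  of degree below \<open>M\<close>; relations between the columns thus become identities
  \<open>F * g + G * h = 0\<close>.\<close>

lemma sylvester_block_combination:
  fixes F G :: "'a::comm_ring_1 poly"
  shows "(\<Sum>j<s + M. smult (c j) (sylvester_block F G s j)) =
           F * (\<Sum>j<s. monom (c j) j) + G * (\<Sum>j<M. monom (c (s + j)) j)"
proof -
  have "(\<Sum>j<s + M. smult (c j) (sylvester_block F G s j)) =
          (\<Sum>j<s. smult (c j) (sylvester_block F G s j)) +
          (\<Sum>j<M. smult (c (s + j)) (sylvester_block F G s (s + j)))"
    by (induction M) (simp_all add: add.assoc)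
  also have "(\<Sum>j<s. smult (c j) (sylvester_block F G s j)) = F * (\<Sum>j<s. monom (c j) j)"
    by (simp add: sylvester_block_def sum_distrib_left smult_monom flip: mult_smult_right)
  also have "(\<Sum>j<M. smult (c (s + j)) (sylvester_block F G s (s + j))) =
               G * (\<Sum>j<M. monom (c (s + j)) j)"
    by (simp add: sylvester_block_def sum_distrib_left smult_monom flip: mult_smult_right)
  finally show ?thesis .
qed

section \<open>Polynomials given by coefficients or by roots\<close>

lemma coeff_sum_monom: "coeff (\<Sum>j<m. monom (c j) j) i = (if i < m then c i else 0)"
  by (simp add: coeff_sum)

lemma poly_eq_sum_monom:
  assumes "degree p < m"
  shows "(\<Sum>j<m. monom (coeff p j) j) = p"
  using assms by (intro poly_eqI) (simp add: coeff_sum_monom coeff_eq_0)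

lemma sum_monom_eq_0_if_roots:
  fixes c :: "nat \<Rightarrow> 'a::idom"
  assumes "finite R" "m \<le> card R" "\<And>x. x \<in> R \<Longrightarrow> poly (\<Sum>j<m. monom (c j) j) x = 0"
  shows "(\<Sum>j<m. monom (c j) j) = 0"
proof (rule ccontr)
  let ?g = "\<Sum>j<m. monom (c j) j"
  assume nz: "?g \<noteq> 0"
  then have "m > 0"
    by (cases m) auto
  have "degree ?g \<le> m - 1"
    by (rule degree_le) (use \<open>m > 0\<close> in \<open>auto simp: coeff_sum_monom\<close>)
  moreover have "card R \<le> card {x. poly ?g x = 0}"
    using assms nz by (intro card_mono poly_roots_finite) auto
  moreover have "card {x. poly ?g x = 0} \<le> degree ?g"
    using nz by (rule card_poly_roots_bound)
  ultimately show False
    using \<open>m > 0\<close> assms(2) by linarith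
qed

text \<open>Elements of the ground set are read as field elements, which stay distinct in
  characteristic 0. For infinite \<open>A\<close> the product is 1 and \<open>card A\<close> is 0,
  so the degree formula below holds for every \<open>A\<close>.\<close>

definition root_poly :: "nat set \<Rightarrow> 'a::field_char_0 poly" where
  "root_poly A = (\<Prod>x\<in>A. [:- of_nat x, 1:])"

lemma root_poly_nonzero: "root_poly A \<noteq> 0"
  by (cases "finite A") (auto simp: root_poly_def)

lemma degree_root_poly: "degree (root_poly A) = card A"
  by (cases "finite A") (auto simp: root_poly_def degree_prod_eq_sum_degree)

lemma poly_root_poly_eq_0_iff:
  "finite A \<Longrightarrow> poly (root_poly A) (of_nat x) = 0 \<longleftrightarrow> x \<in> A"
  by (auto simp: root_poly_def poly_prod)

lemma root_poly_Un_disjoint: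
  "finite A \<Longrightarrow> finite B \<Longrightarrow> A \<inter> B = {} \<Longrightarrow> root_poly (A \<union> B) = root_poly A * root_poly B"
  by (simp add: root_poly_def prod.union_disjoint)

text \<open>The coefficients of \<open>g\<close> followed by those of \<open>h\<close> form a
  nonzero kernel vector, whatever the points are.\<close>

lemma det_sylvester_mat_eq_0:
  fixes \<beta> :: "nat \<Rightarrow> 'a::field"
  assumes "F * g + G * h = 0" "degree g < s" "degree h < M" "g \<noteq> 0"
  shows "det (sylvester_mat (s + M) s \<beta> F G) = 0"
proof -
  define c where "c j = (if j < s then coeff g j else coeff h (j - s))" for j
  let ?v = "vec (s + M) c"
  let ?A = "sylvester_mat (s + M) s \<beta> F G"
  have "(\<Sum>j<s. monom (c j) j) = g"
    using poly_eq_sum_monom[OF assms(2)] by (simp add: c_def)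
  moreover have "(\<Sum>j<M. monom (c (s + j)) j) = h"
    using poly_eq_sum_monom[OF assms(3)] by (simp add: c_def)
  ultimately have comb: "(\<Sum>j<s + M. smult (c j) (sylvester_block F G s j)) = 0"
    using assms(1) by (simp add: sylvester_block_combination)
  have "lead_coeff g \<noteq> 0"
    using assms by simp
  then have "c (degree g) \<noteq> 0"
    using assms by (simp add: c_def)
  then have "?v \<noteq> 0\<^sub>v (s + M)"
    using assms(2) by (metis index_vec index_zero_vec(1) trans_less_add1)
  moreover have "?A *\<^sub>v ?v = 0\<^sub>v (s + M)"
  proof (intro eq_vecI)
    fix r assume r: "r < dim_vec (0\<^sub>v (s + M) :: 'a vec)"
    then have "(?A *\<^sub>v ?v) $ r = (\<Sum>j<s + M. poly (sylvester_block F G s j) (\<beta> r) * c j)"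
      by (simp add: sylvester_mat_def scalar_prod_def lessThan_atLeast0)
    also have "\<dots> = poly (\<Sum>j<s + M. smult (c j) (sylvester_block F G s j)) (\<beta> r)"
      by (simp add: poly_sum mult.commute)
    finally show "(?A *\<^sub>v ?v) $ r = 0\<^sub>v (s + M) $ r"
      using r comb by simp
  qed (simp add: sylvester_mat_def)
  ultimately show ?thesis
    by (subst det_0_iff_vec_prod_zero[where n = "s + M"])
       (auto simp: sylvester_mat_def intro!: exI[of _ ?v])
qed

lemma card_Un_Int_subset:
  fixes U v w :: "'a set"
  assumes "finite U" "v \<subseteq> U" "w \<subseteq> U"
  shows "card (U - (v \<union> w)) + card v + card w = card U + card (v \<inter> w)"
proof -
  have fin: "finite v" "finite w"
    using assms finite_subset by blast+
  have "card (U - (v \<union> w)) + card (v \<union> w) = card U"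
    using assms by (metis Un_least card_Diff_subset card_mono fin finite_UnI le_add_diff_inverse2)
  then show ?thesis
    using card_Un_Int[OF fin] by simp
qed

text \<open>The complement of \<open>w - v\<close> in \<open>U\<close> splits into
  \<open>U - w\<close> and \<open>v \<inter> w\<close>, and also into \<open>v\<close> and
  \<open>U - (v \<union> w)\<close>. Equating the two products of root polynomials gives the
  relation; a small intersection makes both cofactors have small degree.\<close>

lemma det_sylvester_mat_root_poly_eq_0:
  fixes \<beta> :: "nat \<Rightarrow> 'a::field_char_0"
  assumes "finite U" "v \<subseteq> U" "w \<subseteq> U" "card v = k" "card w = k" "card U + s = 2 * k + M"
    and "card (v \<inter> w) < s"
  shows "det (sylvester_mat (s + M) s \<beta> (root_poly (U - w)) (root_poly v)) = 0"
proof (rule det_sylvester_mat_eq_0)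
  have fin: "finite v" "finite w"
    using assms finite_subset by blast+
  have "root_poly (U - w) * root_poly (v \<inter> w) = (root_poly ((U - w) \<union> (v \<inter> w)) :: 'a poly)"
    using assms fin by (intro root_poly_Un_disjoint[symmetric]) auto
  also have "(U - w) \<union> (v \<inter> w) = v \<union> (U - (v \<union> w))"
    using assms by blast
  also have "root_poly \<dots> = (root_poly v * root_poly (U - (v \<union> w)) :: 'a poly)"
    using assms fin by (intro root_poly_Un_disjoint) auto
  finally show "root_poly (U - w) * root_poly (v \<inter> w) + root_poly v * (- root_poly (U - (v \<union> w))) =
      (0 :: 'a poly)"
    by simp
  show "degree (root_poly (v \<inter> w) :: 'a poly) < s"
    using assms by (simp add: degree_root_poly)
  show "degree (- root_poly (U - (v \<union> w)) :: 'a poly) < M"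
    using card_Un_Int_subset[of U v w] assms by (simp add: degree_root_poly)
  show "root_poly (v \<inter> w) \<noteq> (0 :: 'a poly)"
    by (rule root_poly_nonzero)
qed

text \<open>
  A relation \<open>F g + G h = 0\<close> forces \<open>g\<close> to vanish on \<open>v \<inter> w\<close>, where \<open>G\<close> is zero and \<open>F\<close> is not.
\<close>

lemma sylvester_block_root_poly_independent:
  fixes c :: "nat \<Rightarrow> 'a::field_char_0"
  assumes "finite U" "v \<subseteq> U" "w \<subseteq> U" "s \<le> card (v \<inter> w)"
    and rel: "(\<Sum>j<s + M. smult (c j) (sylvester_block (root_poly (U - w)) (root_poly v) s j)) = 0"
  shows "\<forall>j<s + M. c j = 0"
proof -
  let ?g = "\<Sum>j<s. monom (c j) j" and ?h = "\<Sum>j<M. monom (c (s + j)) j"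
  have fin: "finite v" "finite w"
    using assms finite_subset by blast+
  have eq: "root_poly (U - w) * ?g + root_poly v * ?h = 0"
    using rel by (simp only: sylvester_block_combination)
  have g: "?g = 0"
  proof (rule sum_monom_eq_0_if_roots)
    show "finite ((of_nat :: nat \<Rightarrow> 'a) ` (v \<inter> w))"
      using fin by simp
    show "s \<le> card ((of_nat :: nat \<Rightarrow> 'a) ` (v \<inter> w))"
      using assms by (simp add: card_image inj_on_def)
    fix y :: 'a assume "y \<in> of_nat ` (v \<inter> w)"
    then obtain x where x: "x \<in> v" "x \<in> w" "y = of_nat x"
      by auto
    have "poly (root_poly (U - w) * ?g + root_poly v * ?h) y = 0"
      by (simp only: eq poly_0)
    moreover have "poly (root_poly v) y = 0" "poly (root_poly (U - w)) y \<noteq> 0"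
      using x fin assms(1) by (simp_all add: poly_root_poly_eq_0_iff)
    ultimately show "poly ?g y = 0"
      by simp
  qed
  have "?h = 0"
    using eq unfolding g by (simp add: root_poly_nonzero)
  show ?thesis
  proof (intro allI impI)
    fix j assume "j < s + M"
    show "c j = 0"
    proof (cases "j < s")
      case True
      then show ?thesis
        using arg_cong[OF g, of "\<lambda>p. coeff p j"] by (simp add: coeff_sum_monom)
    next
      case False
      then show ?thesis
        using arg_cong[OF \<open>?h = 0\<close>, of "\<lambda>p. coeff p (j - s)"] \<open>j < s + M\<close>
        by (simp add: coeff_sum_monom split: if_splits)
    qed
  qed
qed

section \<open>The bound for skew families\<close>

text \<open>With more pairs than \<open>s\<close>-subsets \<open>T\<close> of the rows, the vectors
  of products of \<open>F j\<close> over \<open>T\<close> are linearly dependent. By the expansion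
  the same relation \<open>a\<close> then holds between the determinants for every fixed
  \<open>G i\<close>.\<close>

lemma skew_threshold_set_pair_bound:
  fixes v w :: "nat \<Rightarrow> nat set"
  assumes U: "finite U" "card U + s = 2 * k + M"
    and v: "\<And>i. i < m \<Longrightarrow> v i \<subseteq> U \<and> card (v i) = k"
    and w: "\<And>i. i < m \<Longrightarrow> w i \<subseteq> U \<and> card (w i) = k"
    and diag: "\<And>i. i < m \<Longrightarrow> s \<le> card (v i \<inter> w i)"
    and skew: "\<And>i j. i < j \<Longrightarrow> j < m \<Longrightarrow> card (v i \<inter> w j) < s"
  shows "m \<le> (s + M choose s)"
proof (rule ccontr)
  assume "\<not> m \<le> (s + M choose s)"
  define F where "F j = (root_poly (U - w j) :: real poly)" for j
  define G where "G i = (root_poly (v i) :: real poly)" for i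
  define \<T> where "\<T> = {T. T \<subseteq> {0..<s + M} \<and> card T = s}"
  have "\<exists>\<beta>. \<forall>i\<in>{..<m}. det (mat (s + M) (s + M)
          (\<lambda>(r, j). poly (sylvester_block (F i) (G i) s j) (\<beta> r))) \<noteq> 0"
  proof (rule exists_common_evaluation_points)
    fix i :: nat and c :: "nat \<Rightarrow> real"
    assume "i \<in> {..<m}" "(\<Sum>j<s + M. smult (c j) (sylvester_block (F i) (G i) s j)) = 0"
    then show "\<forall>j<s + M. c j = 0"
      unfolding F_def G_def using U(1) v w diag
      by (intro sylvester_block_root_poly_independent[of U "v i" "w i"]) auto
  qed simp
  then obtain \<beta> where \<beta>: "\<And>i. i < m \<Longrightarrow> det (sylvester_mat (s + M) s \<beta> (F i) (G i)) \<noteq> 0"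
    unfolding sylvester_mat_def by auto
  obtain c where c: "\<And>F G. det (sylvester_mat (s + M) s \<beta> F G) =
      (\<Sum>T\<in>\<T>. c T * (\<Prod>r\<in>T. poly F (\<beta> r)) * (\<Prod>r\<in>{0..<s + M} - T. poly G (\<beta> r)))"
    using det_sylvester_mat_expansion[of s "s + M" \<beta>] unfolding \<T>_def by auto
  have "finite \<T>" "card \<T> = (s + M choose s)"
    using n_subsets[of "{0..<s + M}" s] by (auto simp: \<T>_def)
  then have "\<exists>a. (\<exists>j\<in>{..<m}. a j \<noteq> 0) \<and>
      (\<forall>T\<in>\<T>. (\<Sum>j\<in>{..<m}. a j * (\<Prod>r\<in>T. poly (F j) (\<beta> r))) = 0)"
    using \<open>\<not> m \<le> (s + M choose s)\<close> by (intro exists_nontrivial_linear_relation) auto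
  then obtain a where a: "\<exists>j<m. a j \<noteq> 0"
      "\<And>T. T \<in> \<T> \<Longrightarrow> (\<Sum>j<m. a j * (\<Prod>r\<in>T. poly (F j) (\<beta> r))) = 0"
    by auto
  \<comment> \<open>Minimality of \<open>i\<close> removes the terms with \<open>j < i\<close>,
    skewness those with \<open>j > i\<close>; the diagonal term alone would have to vanish.\<close>
  define i where "i = (LEAST j. j < m \<and> a j \<noteq> 0)"
  have i: "i < m" "a i \<noteq> 0"
    using LeastI_ex[OF a(1)] by (auto simp: i_def)
  have least: "a j = 0" if "j < i" for j
    using not_less_Least[of j "\<lambda>j. j < m \<and> a j \<noteq> 0"] that i(1) by (auto simp: i_def)
  have "(\<Sum>j<m. a j * det (sylvester_mat (s + M) s \<beta> (F j) (G i))) =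
          (\<Sum>T\<in>\<T>. c T * (\<Prod>r\<in>{0..<s + M} - T. poly (G i) (\<beta> r)) *
             (\<Sum>j<m. a j * (\<Prod>r\<in>T. poly (F j) (\<beta> r))))"
    unfolding c sum_distrib_left by (subst sum.swap) (simp add: ac_simps)
  also have "\<dots> = 0"
    using a(2) by simp
  also have "(\<Sum>j<m. a j * det (sylvester_mat (s + M) s \<beta> (F j) (G i))) =
               (\<Sum>j<m. if j = i then a i * det (sylvester_mat (s + M) s \<beta> (F i) (G i)) else 0)"
  proof (intro sum.cong refl)
    fix j assume "j \<in> {..<m}"
    then have "det (sylvester_mat (s + M) s \<beta> (F j) (G i)) = 0" if "j > i"
      unfolding F_def G_def using that U v[OF i(1)] w[of j] skew[of i j]
      by (intro det_sylvester_mat_root_poly_eq_0) auto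
    then show "a j * det (sylvester_mat (s + M) s \<beta> (F j) (G i)) =
        (if j = i then a i * det (sylvester_mat (s + M) s \<beta> (F i) (G i)) else 0)"
      using least[of j] by (cases j i rule: linorder_cases) auto
  qed
  also have "\<dots> = a i * det (sylvester_mat (s + M) s \<beta> (F i) (G i))"
    using i(1) by simp
  finally show False
    using i \<beta> by simp
qed

section \<open>Connectivity through swaps\<close>

text \<open>Common neighbours are assembled from pieces of disjoint sets; this lets a piece catch
  \<open>y\<close> whenever \<open>y\<close> lies in the set from which the piece is taken.\<close>

lemma obtain_subset_containing:
  assumes "finite X" "m \<le> card X" "y \<in> X \<Longrightarrow> 1 \<le> m"
  obtains P where "P \<subseteq> X" "card P = m" "y \<in> X \<Longrightarrow> y \<in> P"
proof (cases "y \<in> X")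
  case True
  then have "m - 1 \<le> card (X - {y})"
    using assms by simp
  then obtain Q where Q: "Q \<subseteq> X - {y}" "card Q = m - 1"
    using assms(1) by (metis obtain_subset_with_card_n)
  have "finite Q"
    using Q assms(1) finite_subset by blast
  have "y \<notin> Q"
    using Q by blast
  then have "card (insert y Q) = m"
    using Q(2) True assms(3) \<open>finite Q\<close> by simp
  then show thesis
    using Q True by (intro that[of "insert y Q"]) auto
next
  case False
  obtain Q where "Q \<subseteq> X" "card Q = m"
    using assms(1,2) by (metis obtain_subset_with_card_n)
  then show thesis
    using False that by blast
qed

text \<open>The sets being swapped are \<open>insert a Z\<close> and \<open>insert b Z\<close>;
  their intersection is \<open>Z\<close>.\<close>

definition swap_pair :: "'a set \<Rightarrow> nat \<Rightarrow> 'a set \<Rightarrow> 'a \<Rightarrow> 'a \<Rightarrow> bool" where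
  "swap_pair U k Z a b \<longleftrightarrow> Z \<subseteq> U \<and> a \<in> U \<and> b \<in> U \<and> a \<notin> Z \<and> b \<notin> Z \<and> a \<noteq> b \<and> Suc (card Z) = k"

lemma swap_pair_card_outside:
  assumes "finite U" "swap_pair U k Z a b"
  shows "card (U - insert a (insert b Z)) + Suc k = card U"
proof -
  have "finite Z"
    using assms finite_subset unfolding swap_pair_def by blast
  have "insert a (insert b Z) \<subseteq> U"
    using assms unfolding swap_pair_def by blast
  then have "card (U - insert a (insert b Z)) + card (insert a (insert b Z)) = card U"
    using assms(1) by (metis card_Diff_subset card_mono finite_subset le_add_diff_inverse2)
  moreover have "card (insert a (insert b Z)) = Suc k"
    using assms(2) \<open>finite Z\<close> unfolding swap_pair_def by auto
  ultimately show ?thesis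
    by simp
qed

text \<open>
  A common neighbour of \<open>Z \<union> {a}\<close> and \<open>Z \<union> {b}\<close> contains either both of \<open>a\<close>, \<open>b\<close> or neither;
  which choice is made depends on the position of \<open>y\<close>.
\<close>

lemma swap_pair_common_neighbour:
  assumes U: "finite U" "y \<in> U" and Z: "swap_pair U k Z a b"
    and d: "1 \<le> d" "d < k" "2 * k \<le> card U + d" "2 \<le> d \<or> 2 * k < card U + d"
  obtains C where "C \<subseteq> U" "card C = k" "y \<in> C" "card (insert a Z \<inter> C) = d" "card (insert b Z \<inter> C) = d"
proof -
  let ?O = "U - insert a (insert b Z)"
  have Z': "Z \<subseteq> U" "a \<in> U" "b \<in> U" "a \<notin> Z" "b \<notin> Z" "a \<noteq> b" "Suc (card Z) = k"
    using Z by (auto simp: swap_pair_def)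
  have fin: "finite Z" "finite ?O"
    using U(1) Z'(1) finite_subset by auto
  have O: "card ?O + Suc k = card U"
    using swap_pair_card_outside[OF U(1) Z] .
  show thesis
  \<comment> \<open>Both \<open>a\<close> and \<open>b\<close> are taken if \<open>y\<close> is one
    of them, or if the outside has only \<open>k - d - 1\<close> elements, too few for a neighbour
    that avoids both.\<close>
  proof (cases "y \<in> {a, b} \<or> card U + d = 2 * k")
    case True
    \<comment> \<open>If \<open>y\<close> is in \<open>Z\<close>, this is the tight case, where the
      hypothesis gives \<open>2 \<le> d\<close>.\<close>
    have "y \<in> Z \<Longrightarrow> 1 \<le> d - 1"
      using True d Z' by auto
    moreover have "d - 1 \<le> card Z"
      using d Z' by linarith
    ultimately obtain P where P: "P \<subseteq> Z" "card P = d - 1" "y \<in> Z \<Longrightarrow> y \<in> P"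
      using obtain_subset_containing[of Z "d - 1" y] fin(1) by blast
    have "\<exists>Q. Q \<subseteq> ?O \<and> card Q = k - d - 1 \<and> (y \<in> ?O \<longrightarrow> y \<in> Q)"
    proof (cases "y \<in> {a, b}")
      case True
      have "k - d - 1 \<le> card ?O"
        using O d by linarith
      then show ?thesis
        using True fin(2) by (metis DiffD2 insertCI insertE obtain_subset_with_card_n singletonD)
    next
      case False
      then show ?thesis
        using True O by (intro exI[of _ ?O]) auto
    qed
    then obtain Q where Q: "Q \<subseteq> ?O" "card Q = k - d - 1" "y \<in> ?O \<Longrightarrow> y \<in> Q"
      by blast
    have finPQ: "finite P" "finite Q"
      using P Q fin finite_subset by blast+
    have disj: "P \<inter> Q = {}" "a \<notin> P \<union> Q" "b \<notin> P \<union> Q"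
      using P Q Z' by auto
    let ?C = "insert a (insert b (P \<union> Q))"
    have "card ?C = k"
      using disj finPQ Z' P Q d by (simp add: card_Un_disjoint)
    moreover have "insert a Z \<inter> ?C = insert a P" "insert b Z \<inter> ?C = insert b P"
      using P Q Z' by auto
    moreover have "card (insert a P) = d" "card (insert b P) = d"
      using disj finPQ P d by simp_all
    moreover have "?C \<subseteq> U" "y \<in> ?C"
      using P Q Z' U by auto
    ultimately show thesis
      by (intro that[of ?C]) simp_all
  next
    case False
    have "d \<le> card Z"
      using d Z' by linarith
    then obtain P where P: "P \<subseteq> Z" "card P = d" "y \<in> Z \<Longrightarrow> y \<in> P"
      using obtain_subset_containing[of Z d y] fin(1) d(1) by blast
    have "k - d \<le> card ?O"
      using O d False by linarith
    moreover have "1 \<le> k - d"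
      using d by linarith
    ultimately obtain Q where Q: "Q \<subseteq> ?O" "card Q = k - d" "y \<in> ?O \<Longrightarrow> y \<in> Q"
      using obtain_subset_containing[of ?O "k - d" y] fin(2) by blast
    have finPQ: "finite P" "finite Q"
      using P Q fin finite_subset by blast+
    have "P \<inter> Q = {}"
      using P Q Z' by auto
    then have "card (P \<union> Q) = k"
      using finPQ P Q d by (simp add: card_Un_disjoint)
    moreover have "insert a Z \<inter> (P \<union> Q) = P" "insert b Z \<inter> (P \<union> Q) = P"
      using P Q Z' by auto
    moreover have "P \<union> Q \<subseteq> U" "y \<in> P \<union> Q"
      using P Q Z' U False by auto
    ultimately show thesis
      using P by (intro that[of "P \<union> Q"]) simp_all
  qed
qed

text \<open>A detour for an obstructed swap: exchange \<open>z\<close> for \<open>o'\<close>, then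
  \<open>a\<close> for \<open>b\<close>, then \<open>o'\<close> for \<open>z\<close>. Each of these
  swaps has an intersection other than \<open>Z\<close> and a union that contains \<open>o'\<close>,
  so it avoids an obstruction tied to \<open>Z\<close> or to the union of the original pair.\<close>

lemma swap_pair_three_swaps:
  assumes U: "finite U" and Z: "swap_pair U k Z a b" and z: "z \<in> Z" and o: "o' \<in> U - insert a (insert b Z)"
    and R: "transp R" and B: "insert o' (insert a (Z - {z})) \<in> B" "insert o' (insert b (Z - {z})) \<in> B"
      "insert a Z \<in> B" "insert b Z \<in> B"
    and swap: "\<And>Z' c d. \<lbrakk>swap_pair U k Z' c d; insert c Z' \<in> B; insert d Z' \<in> B; Z' \<noteq> Z;
        insert c (insert d Z') \<noteq> insert a (insert b Z)\<rbrakk> \<Longrightarrow> R (insert c Z') (insert d Z')"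
  shows "R (insert a Z) (insert b Z)"
proof -
  have Z': "Z \<subseteq> U" "a \<in> U" "b \<in> U" "a \<notin> Z" "b \<notin> Z" "a \<noteq> b" "Suc (card Z) = k"
    using Z by (auto simp: swap_pair_def)
  have fin: "finite Z"
    using U Z'(1) finite_subset by blast
  have card: "Suc (card (Z - {z})) = card Z"
    using fin z by (metis card_Suc_Diff1)
  have "R (insert z (insert a (Z - {z}))) (insert o' (insert a (Z - {z})))"
    using z o Z' card fin B by (intro swap) (auto simp: swap_pair_def insert_absorb insert_commute[of z a])
  moreover have "R (insert a (insert o' (Z - {z}))) (insert b (insert o' (Z - {z})))"
    using z o Z' card fin B
    by (intro swap) (auto simp: swap_pair_def insert_commute[of a o'] insert_commute[of b o'])
  moreover have "R (insert o' (insert b (Z - {z}))) (insert z (insert b (Z - {z})))"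
    using z o Z' card fin B by (intro swap) (auto simp: swap_pair_def insert_absorb insert_commute[of z b])
  moreover have "insert z (insert a (Z - {z})) = insert a Z" "insert z (insert b (Z - {z})) = insert b Z"
    using z by auto
  ultimately show ?thesis
    using R by (metis insert_commute transpD)
qed

text \<open>Exchanging an element of \<open>A - A'\<close> for one of \<open>A' - A\<close> brings
  \<open>A\<close> closer to \<open>A'\<close> and keeps \<open>y\<close>, which lies in
  both.\<close>

lemma swap_connected_star:
  assumes U: "finite U" and R: "reflp R" "transp R"
    and swap: "\<And>Z a b. \<lbrakk>swap_pair U k Z a b; y \<in> insert a Z; y \<in> insert b Z\<rbrakk> \<Longrightarrow>
        R (insert a Z) (insert b Z)"
    and "A \<subseteq> U" "card A = k" "y \<in> A" and A': "A' \<subseteq> U" "card A' = k" "y \<in> A'"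
  shows "R A A'"
  using assms(5-7)
proof (induction "card (A - A')" arbitrary: A rule: less_induct)
  case less
  have fin: "finite A" "finite A'"
    using U less.prems A' finite_subset by blast+
  show ?case
  proof (cases "A = A'")
    case True
    then show ?thesis
      using R by (simp add: reflpD)
  next
    case False
    then obtain a where a: "a \<in> A" "a \<notin> A'"
      using card_subset_eq[OF fin(2), of A] less.prems A' by auto
    from False obtain b where b: "b \<in> A'" "b \<notin> A"
      using card_subset_eq[OF fin(1), of A'] less.prems A' by auto
    let ?Z = "A - {a}"
    have "insert b ?Z - A' \<subset> A - A'"
      using a b by auto
    then have "card (insert b ?Z - A') < card (A - A')"
      using fin by (intro psubset_card_mono) auto
    moreover have card: "Suc (card ?Z) = k"
      using a fin less.prems by (metis card_Suc_Diff1)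
    moreover have "y \<in> ?Z" "?Z \<subseteq> U" "b \<in> U"
      using a b A' less.prems by auto
    ultimately have "R (insert b ?Z) A'"
      using fin b by (intro less.hyps) auto
    moreover have "R (insert a ?Z) (insert b ?Z)"
      using a b card less.prems \<open>y \<in> ?Z\<close> \<open>b \<in> U\<close> by (intro swap) (auto simp: swap_pair_def)
    moreover have "insert a ?Z = A"
      using a by auto
    ultimately show ?thesis
      using R by (metis transpD)
  qed
qed

text \<open>
  Any set is one swap away from a set that contains \<open>y\<close>, so only swaps have to be realised.
\<close>

lemma swap_connected:
  assumes U: "finite U" "y \<in> U" "0 < k" and R: "reflp R" "transp R" "symp R"
    and B: "B \<subseteq> {A. A \<subseteq> U \<and> card A = k}" "\<And>A. A \<subseteq> U \<Longrightarrow> card A = k \<Longrightarrow> y \<in> A \<Longrightarrow> A \<in> B"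
    and swap: "\<And>Z a b. \<lbrakk>swap_pair U k Z a b; insert a Z \<in> B; insert b Z \<in> B\<rbrakk> \<Longrightarrow>
        R (insert a Z) (insert b Z)"
    and "A \<in> B" "A' \<in> B"
  shows "R A A'"
proof -
  have star: "\<exists>C. C \<subseteq> U \<and> card C = k \<and> y \<in> C \<and> R D C" if "D \<in> B" for D
  proof (cases "y \<in> D")
    case True
    then show ?thesis
      using R(1) B(1) that by (intro exI[of _ D]) (auto simp: reflpD)
  next
    case False
    have D: "D \<subseteq> U" "card D = k"
      using B(1) that by auto
    then have fin: "finite D"
      using U finite_subset by blast
    obtain z where z: "z \<in> D"
      using D(2) U(3) by fastforce
    let ?Z = "D - {z}"
    have card: "Suc (card ?Z) = k"
      using z fin D by (metis card_Suc_Diff1)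
    then have "card (insert y ?Z) = k"
      using fin False by simp
    moreover have "insert y ?Z \<subseteq> U"
      using D U by auto
    ultimately have "insert y ?Z \<in> B"
      using B(2) by blast
    moreover have "insert z ?Z = D"
      using z by auto
    moreover have "swap_pair U k ?Z z y"
      using card D U z False by (auto simp: swap_pair_def)
    ultimately have "R D (insert y ?Z)"
      using swap[of ?Z z y] that by simp
    then show ?thesis
      using \<open>card (insert y ?Z) = k\<close> \<open>insert y ?Z \<subseteq> U\<close> by blast
  qed
  obtain C C' where C: "C \<subseteq> U" "card C = k" "y \<in> C" "R A C" and C': "C' \<subseteq> U" "card C' = k" "y \<in> C'" "R A' C'"
    using star assms by meson
  have "R C C'"
  proof (rule swap_connected_star[OF U(1) R(1,2)])
    fix Z a b assume *: "swap_pair U k Z a b" "y \<in> insert a Z" "y \<in> insert b Z"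
    then have "finite Z"
      using U(1) finite_subset unfolding swap_pair_def by blast
    then show "R (insert a Z) (insert b Z)"
      using * unfolding swap_pair_def by (intro swap B(2)) (auto simp: swap_pair_def)
  qed (use C C' in auto)
  then show ?thesis
    using C(4) C'(4) R by (metis sympD transpD)
qed

section \<open>Walks in induced subgraphs\<close>

text \<open>Reachability in the subgraph induced by \<open>B\<close>; membership in the vertex set
  of the whole graph is left to the choice of \<open>B\<close>.\<close>

definition johnson_link :: "nat set \<Rightarrow> 'a set set \<Rightarrow> 'a set \<Rightarrow> 'a set \<Rightarrow> bool" where
  "johnson_link S B = (\<lambda>A C. A \<in> B \<and> C \<in> B \<and> A \<noteq> C \<and> card (A \<inter> C) \<in> S)\<^sup>*\<^sup>*"

lemma johnson_link_step:
  "\<lbrakk>A \<in> B; C \<in> B; A \<noteq> C; card (A \<inter> C) \<in> S\<rbrakk> \<Longrightarrow> johnson_link S B A C"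
  unfolding johnson_link_def by (rule r_into_rtranclp) simp

lemma reflp_johnson_link: "reflp (johnson_link S B)"
  by (simp add: johnson_link_def reflpI)

lemma transp_johnson_link: "transp (johnson_link S B)"
  unfolding johnson_link_def by (intro transpI) (rule rtranclp_trans)

lemma symp_johnson_link: "symp (johnson_link S B)"
  unfolding johnson_link_def
  by (rule symp_rtranclp) (auto intro!: sympI simp: Int_commute)

lemma johnson_link_common_neighbour:
  assumes "A \<in> B" "A' \<in> B" "C \<in> B" "card (A \<inter> C) = d" "card (A' \<inter> C) = d" "d \<in> S" "card C \<noteq> d"
  shows "johnson_link S B A A'"
proof -
  \<comment> \<open>If \<open>C\<close> were one of the two sets, its intersection with that set
    would be \<open>C\<close> itself, of size other than \<open>d\<close>.\<close>
  have "A \<noteq> C" "A' \<noteq> C"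
    using assms by auto
  then have "johnson_link S B A C" "johnson_link S B C A'"
    using assms by (auto intro!: johnson_link_step simp: Int_commute)
  then show ?thesis
    using transp_johnson_link by (metis transpD)
qed

text \<open>At least \<open>k\<close> elements lie outside \<open>insert a (insert b Z)\<close>, and
  any \<open>k\<close> of them form a common neighbour. Only if the outside is exactly the missing
  vertex \<open>w\<close> does this fail.\<close>

lemma johnson_link_swap_disjoint:
  assumes U: "finite U" "2 * k < card U" and "0 \<in> S" and w: "w \<subseteq> U" "card w = k"
    and B: "B = {A. A \<subseteq> U \<and> card A = k} - {w}"
    and Z: "swap_pair U k Z a b" "insert a Z \<in> B" "insert b Z \<in> B"
  shows "johnson_link S B (insert a Z) (insert b Z)"
proof -
  have good: "johnson_link S B (insert a Z) (insert b Z)"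
    if Z: "swap_pair U k Z a b" "insert a Z \<in> B" "insert b Z \<in> B"
      and neq: "U - insert a (insert b Z) \<noteq> w" for Z a b
  proof -
    let ?O = "U - insert a (insert b Z)"
    have O: "finite ?O" "k \<le> card ?O"
      using swap_pair_card_outside[OF U(1) Z(1)] U by simp_all
    obtain C where C: "C \<subseteq> ?O" "card C = k" "C \<noteq> w"
    proof (cases "?O \<subseteq> w")
      case True
      have "finite w"
        using U(1) w(1) finite_subset by blast
      then have "?O = w"
        using True O(2) w(2) by (intro card_seteq) auto
      then show ?thesis
        using neq by blast
    next
      case False
      then obtain y where y: "y \<in> ?O" "y \<notin> w"
        by blast
      have "1 \<le> k"
        using Z(1) by (auto simp: swap_pair_def)
      then obtain C where "C \<subseteq> ?O" "card C = k" "y \<in> C"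
        using obtain_subset_containing[of ?O k y] O y(1) by blast
      then show ?thesis
        using that y(2) by blast
    qed
    have "C \<in> B"
      using C B by auto
    moreover have "insert a Z \<inter> C = {}" "insert b Z \<inter> C = {}"
      using C(1) by auto
    moreover have "0 < k"
      using Z(1) by (auto simp: swap_pair_def)
    ultimately show ?thesis
      using Z C \<open>0 \<in> S\<close> by (intro johnson_link_common_neighbour[where d = 0 and C = C]) auto
  qed
  show ?thesis
  proof (cases "U - insert a (insert b Z) = w")
    case True
    have Z': "Z \<subseteq> U" "a \<in> U" "b \<in> U" "a \<notin> Z" "b \<notin> Z" "a \<noteq> b" "Suc (card Z) = k"
      using Z(1) by (auto simp: swap_pair_def)
    have fin: "finite Z"
      using U(1) Z' finite_subset by blast
    show ?thesis
    \<comment> \<open>For empty \<open>Z\<close> both sets are singletons and adjacent. Otherwise a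
      detour through \<open>x\<close> in \<open>w\<close> works: the intermediate sets contain
      \<open>a\<close> or \<open>b\<close>, hence differ from \<open>w\<close>.\<close>
    proof (cases "Z = {}")
      case True
      then show ?thesis
        using Z Z' \<open>0 \<in> S\<close> by (intro johnson_link_step) auto
    next
      case False
      then obtain z where z: "z \<in> Z"
        by blast
      have "w \<noteq> {}"
        using w(2) Z'(7) by auto
      then obtain x where x: "x \<in> w"
        by blast
      have card: "Suc (card (Z - {z})) = card Z"
        using fin z by (metis card_Suc_Diff1)
      show ?thesis
      proof (rule swap_pair_three_swaps[OF U(1) Z(1) z, of x])
        show "x \<in> U - insert a (insert b Z)"
          using x True by simp
        show "insert x (insert a (Z - {z})) \<in> B" "insert x (insert b (Z - {z})) \<in> B"
          using x True Z' w card fin B by auto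
        show "johnson_link S B (insert c Z') (insert d Z')"
          if "swap_pair U k Z' c d" "insert c Z' \<in> B" "insert d Z' \<in> B"
            "insert c (insert d Z') \<noteq> insert a (insert b Z)" for Z' c d
        proof (rule good[OF that(1-3)])
          have "insert c (insert d Z') \<subseteq> U" "insert a (insert b Z) \<subseteq> U"
            using that(1) Z' by (auto simp: swap_pair_def)
          then show "U - insert c (insert d Z') \<noteq> w"
            using that(4) True by (metis double_diff subset_refl)
        qed
      qed (use Z transp_johnson_link in auto)
    qed
  qed (use good Z in blast)
qed

text \<open>Here \<open>U - Z\<close> has exactly \<open>k\<close> elements and meets the two sets
  in \<open>a\<close> and in \<open>b\<close> alone, so it is a common neighbour unless it is the
  missing vertex \<open>w\<close>.\<close>

lemma johnson_link_swap_tight: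
  assumes U: "finite U" "card U + 1 = 2 * k" and S: "1 \<in> S" and w: "w \<subseteq> U" "card w = k" and k: "2 \<le> k"
    and B: "B = {A. A \<subseteq> U \<and> card A = k} - {w}"
    and Z: "swap_pair U k Z a b" "insert a Z \<in> B" "insert b Z \<in> B"
  shows "johnson_link S B (insert a Z) (insert b Z)"
proof -
  have good: "johnson_link S B (insert a Z) (insert b Z)"
    if Z: "swap_pair U k Z a b" "insert a Z \<in> B" "insert b Z \<in> B" and neq: "U - Z \<noteq> w" for Z a b
  proof -
    have Z': "Z \<subseteq> U" "a \<in> U" "b \<in> U" "a \<notin> Z" "b \<notin> Z" "Suc (card Z) = k"
      using Z(1) by (auto simp: swap_pair_def)
    have "card (U - Z) = card U - card Z"
      using U Z' by (meson card_Diff_subset finite_subset)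
    then have "card (U - Z) = k"
      using U Z' by linarith
    moreover have "insert a Z \<inter> (U - Z) = {a}" "insert b Z \<inter> (U - Z) = {b}"
      using Z' by auto
    ultimately show ?thesis
      using Z S neq B k by (intro johnson_link_common_neighbour[where d = 1 and C = "U - Z"]) auto
  qed
  show ?thesis
  proof (cases "U - Z = w")
    case True
    have Z': "Z \<subseteq> U" "a \<in> U" "b \<in> U" "a \<notin> Z" "b \<notin> Z" "a \<noteq> b" "Suc (card Z) = k"
      using Z(1) by (auto simp: swap_pair_def)
    have fin: "finite Z"
      using U(1) Z' finite_subset by blast
    show ?thesis
    \<comment> \<open>For \<open>k = 2\<close> the two sets meet in the single element of
      \<open>Z\<close> and are adjacent themselves; for larger \<open>k\<close> there is room for a
      detour.\<close>
    proof (cases "k = 2")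
      case True
      have "insert a Z \<inter> insert b Z = Z"
        using Z' by auto
      moreover have "insert a Z \<noteq> insert b Z"
        using Z' by auto
      ultimately show ?thesis
        using Z Z' S True by (intro johnson_link_step) auto
    next
      case False
      have "Z \<noteq> {}"
        using Z' k by auto
      then obtain z where z: "z \<in> Z"
        by blast
      have card: "Suc (card (Z - {z})) = card Z"
        using fin z by (metis card_Suc_Diff1)
      then have "Z - {z} \<noteq> {}"
        using False Z'(7) k by fastforce
      \<comment> \<open>The element \<open>z'\<close> of \<open>Z\<close> stays in the intermediate
        sets of the detour, so they differ from \<open>w = U - Z\<close>.\<close>
      then obtain z' where z': "z' \<in> Z" "z' \<noteq> z"
        by blast
      have "card (U - insert a (insert b Z)) \<noteq> 0"
        using swap_pair_card_outside[OF U(1) Z(1)] U False k by linarith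
      then have "U - insert a (insert b Z) \<noteq> {}"
        by (metis card.empty)
      then obtain x where x: "x \<in> U - insert a (insert b Z)"
        by blast
      show ?thesis
      proof (rule swap_pair_three_swaps[OF U(1) Z(1) z x])
        show "insert x (insert a (Z - {z})) \<in> B" "insert x (insert b (Z - {z})) \<in> B"
          using x z' True Z' w card fin B by auto
        show "johnson_link S B (insert c Z') (insert d Z')"
          if "swap_pair U k Z' c d" "insert c Z' \<in> B" "insert d Z' \<in> B" "Z' \<noteq> Z" for Z' c d
        proof (rule good[OF that(1-3)])
          have "Z' \<subseteq> U"
            using that(1) by (auto simp: swap_pair_def)
          then show "U - Z' \<noteq> w"
            using that(4) True Z'(1) by (metis double_diff subset_refl)
        qed
      qed (use Z transp_johnson_link in auto)
    qed
  qed (use good Z in blast)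
qed

lemma johnson_link_connected:
  assumes U: "finite U" "y \<in> U" and k: "0 < k" and S: "S \<subseteq> {0..k - 1}" "S \<noteq> {}"
    and n: "2 * k - Min S \<le> card U" "\<not> (S = {0} \<and> card U = 2 * k)"
    and B: "B \<subseteq> {A. A \<subseteq> U \<and> card A = k}" "\<And>A. A \<subseteq> U \<Longrightarrow> card A = k \<Longrightarrow> y \<in> A \<Longrightarrow> A \<in> B"
    and single: "S = {0} \<or> card U + Min S = 2 * k \<Longrightarrow>
      \<exists>w. w \<subseteq> U \<and> card w = k \<and> B = {A. A \<subseteq> U \<and> card A = k} - {w}"
    and "A \<in> B" "A' \<in> B"
  shows "johnson_link S B A A'"
proof (rule swap_connected[OF U k reflp_johnson_link transp_johnson_link symp_johnson_link B])
  fix Z a b assume Z: "swap_pair U k Z a b" "insert a Z \<in> B" "insert b Z \<in> B"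
  have finS: "finite S"
    using S(1) finite_subset by blast
  have Min: "Min S \<in> S" "\<And>d. d \<in> S \<Longrightarrow> Min S \<le> d"
    using finS S(2) by auto
  have lt: "d < k" if "d \<in> S" for d
    using S(1) that k by (auto simp: subset_iff Suc_le_eq dest!: bspec)
  show "johnson_link S B (insert a Z) (insert b Z)"
  proof (cases "\<exists>d\<in>S. 1 \<le> d \<and> (2 \<le> d \<or> 2 * k < card U + d)")
    case True
    then obtain d where d: "d \<in> S" "1 \<le> d" "2 \<le> d \<or> 2 * k < card U + d"
      by blast
    have "2 * k \<le> card U + d"
      using n(1) Min(2)[OF d(1)] by linarith
    then obtain C where C: "C \<subseteq> U" "card C = k" "y \<in> C" "card (insert a Z \<inter> C) = d" "card (insert b Z \<inter> C) = d"
      using swap_pair_common_neighbour[OF U Z(1) d(2) lt[OF d(1)] _ d(3)] by metis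
    then show ?thesis
      using Z B(2) d(1) lt[OF d(1)] by (intro johnson_link_common_neighbour[where d = d and C = C]) auto
  next
    \<comment> \<open>Only two situations remain: \<open>S = {0}\<close> with
      \<open>2 * k < card U\<close>, and \<open>Min S = 1\<close> with
      \<open>card U + 1 = 2 * k\<close>. In both, \<open>single\<close> leaves one missing
      vertex.\<close>
    case no_d: False
    show ?thesis
    proof (cases "0 \<in> S")
      case True
      then have "Min S = 0"
        using Min(2) by fastforce
      have "S \<subseteq> {0}"
      proof
        fix d assume "d \<in> S"
        then show "d \<in> {0}"
          using no_d n(1) \<open>Min S = 0\<close> by (cases "d = 0") force+
      qed
      then have "S = {0}"
        using True by blast
      moreover have "2 * k < card U"
        using n \<open>Min S = 0\<close> \<open>S = {0}\<close> by simp
      ultimately show ?thesis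
        using single johnson_link_swap_disjoint[OF U(1) _ True _ _ _ Z] by metis
    next
      case False
      have "1 \<le> Min S"
        using Min(1) False by (metis One_nat_def Suc_leI neq0_conv)
      then have "\<not> (2 \<le> Min S \<or> 2 * k < card U + Min S)"
        using no_d Min(1) by blast
      then have "Min S = 1" "card U + 1 \<le> 2 * k"
        using \<open>1 \<le> Min S\<close> by linarith+
      moreover from this have "card U + 1 = 2 * k"
        using n(1) by linarith
      moreover have "2 \<le> k"
        using lt[OF Min(1)] \<open>Min S = 1\<close> by simp
      ultimately show ?thesis
        using single johnson_link_swap_tight[OF U(1) _ _ _ _ _ _ Z] Min(1) by metis
    qed
  qed
qed (use assms in auto)

section \<open>Zero forcing\<close>

lemma verts_gen_johnson_graph: "pverts (gen_johnson_graph S n k) = {A. A \<subseteq> {1..n} \<and> card A = k}"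
  by (simp add: gen_johnson_graph_def)

lemma gen_johnson_graph_adj_iff:
  "A \<rightarrow>\<^bsub>with_proj (gen_johnson_graph S n k)\<^esub> C \<longleftrightarrow>
     A \<subseteq> {1..n} \<and> card A = k \<and> C \<subseteq> {1..n} \<and> card C = k \<and> A \<noteq> C \<and> card (A \<inter> C) \<in> S"
  by (auto simp: gen_johnson_graph_def)

text \<open>Every white vertex has an initially black neighbour that sees no other white vertex, so
  the forces can be carried out in any order.\<close>

lemma zero_forcing_set_if_private_neighbours:
  assumes fin: "finite (verts G)" and B: "B \<subseteq> verts G"
    and priv: "\<And>w. w \<in> verts G - B \<Longrightarrow> \<exists>v\<in>B. \<forall>u\<in>verts G - B. v \<rightarrow>\<^bsub>G\<^esub> u \<longleftrightarrow> u = w"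
  shows "zero_forcing_set G B"
proof -
  have "(force_step G)\<^sup>*\<^sup>* C (verts G)" if "B \<subseteq> C" "C \<subseteq> verts G" for C
    using that
  proof (induction "card (verts G - C)" arbitrary: C rule: less_induct)
    case less
    show ?case
    proof (cases "C = verts G")
      case False
      then obtain w where w: "w \<in> verts G" "w \<notin> C"
        using less.prems by blast
      then obtain v where v: "v \<in> B" "\<forall>u\<in>verts G - B. v \<rightarrow>\<^bsub>G\<^esub> u \<longleftrightarrow> u = w"
        using priv less.prems by blast
      have "{u \<in> verts G - C. v \<rightarrow>\<^bsub>G\<^esub> u} = {w}"
        using v w less.prems by blast
      then have "force_step G C (insert w C)"
        using v less.prems unfolding force_step_def by blast
      moreover have "card (verts G - insert w C) < card (verts G - C)"
        using w fin by (intro psubset_card_mono) auto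
      then have "(force_step G)\<^sup>*\<^sup>* (insert w C) (verts G)"
        using w less.prems by (intro less.hyps) auto
      ultimately show ?thesis
        by (rule converse_rtranclp_into_rtranclp)
    qed simp
  qed
  then show ?thesis
    using B by (simp add: zero_forcing_set_def)
qed

lemma connected_induce_gen_johnson_graph:
  assumes "B \<noteq> {}" "B \<subseteq> {A. A \<subseteq> {1..n} \<and> card A = k}"
    and "\<And>A A'. A \<in> B \<Longrightarrow> A' \<in> B \<Longrightarrow> johnson_link S B A A'"
  shows "Digraph_Component.connected (with_proj (gen_johnson_graph S n k) \<restriction> B)"
proof -
  let ?G = "with_proj (gen_johnson_graph S n k)"
  interpret pair_graph "gen_johnson_graph S n k"
    by (rule pair_graph_gen_johnson_graph)
  interpret B: wf_digraph "?G \<restriction> B"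
    by (rule wellformed_induce_subgraph)
  show ?thesis
  proof (rule B.connectedI)
    fix A A' assume A: "A \<in> verts (?G \<restriction> B)" "A' \<in> verts (?G \<restriction> B)"
    then have "johnson_link S B A A'"
      using assms(3) by simp
    then have "A \<rightarrow>\<^sup>*\<^bsub>?G \<restriction> B\<^esub> A'"
      unfolding johnson_link_def
    proof (induction rule: rtranclp_induct)
      case base
      show ?case
        using A(1) by (rule B.reachable_refl)
    next
      case (step C D)
      have "C \<rightarrow>\<^bsub>?G \<restriction> B\<^esub> D"
        unfolding dominates_induce_subgraph gen_johnson_graph_adj_iff using step.hyps(2) assms(2) by auto
      with step.IH show ?case
        by (rule B.reachable_adj_trans)
    qed
    then show "A \<rightarrow>\<^sup>*\<^bsub>mk_symmetric (?G \<restriction> B)\<^esub> A'"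
      by (rule B.reachable_mk_symmetricI)
  qed (use assms(1) in simp)
qed

text \<open>A connected induced subgraph has an isolated vertex only if it is a single vertex, and a
  single black vertex with two neighbours cannot force.\<close>

lemma no_isolated_vertices_if_connected_zero_forcing:
  assumes wf: "wf_digraph G" and sym: "symmetric G"
    and two: "\<And>v. v \<in> verts G \<Longrightarrow> \<exists>u w. u \<noteq> w \<and> u \<noteq> v \<and> w \<noteq> v \<and> v \<rightarrow>\<^bsub>G\<^esub> u \<and> v \<rightarrow>\<^bsub>G\<^esub> w"
    and zf: "zero_forcing_set G B" and conn: "Digraph_Component.connected (G \<restriction> B)"
  shows "no_isolated_vertices (G \<restriction> B)"
  unfolding no_isolated_vertices_def
proof
  interpret wf_digraph G
    by (rule wf)
  interpret B: wf_digraph "G \<restriction> B"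
    by (rule wellformed_induce_subgraph)
  fix v assume v: "v \<in> verts (G \<restriction> B)"
  then have v': "v \<in> B" "v \<in> verts G"
    using zf by (auto simp: zero_forcing_set_def)
  show "\<exists>w\<in>verts (G \<restriction> B). v \<rightarrow>\<^bsub>G \<restriction> B\<^esub> w"
  proof (cases "B = {v}")
    case True
    obtain u w where uw: "u \<noteq> w" "u \<noteq> v" "w \<noteq> v" "v \<rightarrow>\<^bsub>G\<^esub> u" "v \<rightarrow>\<^bsub>G\<^esub> w"
      using two[OF v'(2)] by blast
    then have in_verts: "u \<in> verts G" "w \<in> verts G"
      by (simp_all add: adj_in_verts)
    have "(force_step G)\<^sup>*\<^sup>* {v} (verts G)"
      using zf True by (simp add: zero_forcing_set_def)
    then obtain C where "force_step G {v} C"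
      using in_verts uw by (metis converse_rtranclpE singletonD)
    then obtain x where "{y \<in> verts G - {v}. v \<rightarrow>\<^bsub>G\<^esub> y} = {x}"
      by (auto simp: force_step_def)
    moreover have "u \<in> {y \<in> verts G - {v}. v \<rightarrow>\<^bsub>G\<^esub> y}" "w \<in> {y \<in> verts G - {v}. v \<rightarrow>\<^bsub>G\<^esub> y}"
      using uw in_verts by simp_all
    ultimately show ?thesis
      using uw(1) by simp
  next
    case False
    then obtain u where u: "u \<in> B" "u \<noteq> v"
      using v' by blast
    have "symmetric (G \<restriction> B)"
      using sym by (rule induced_graph_imp_symmetric) (rule induced_induce, use zf in \<open>simp add: zero_forcing_set_def\<close>)
    then have "v \<rightarrow>\<^sup>*\<^bsub>G \<restriction> B\<^esub> u"
      using B.symmetric_connected_imp_strongly_connected[OF _ conn] v u unfolding strongly_connected_def by auto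
    then obtain w where "v \<rightarrow>\<^bsub>G \<restriction> B\<^esub> w"
      using u(2) by (metis B.converse_reachable_cases)
    then show ?thesis
      using B.adj_in_verts by blast
  qed
qed

text \<open>For \<open>1 \<le> d < k\<close> the part inside \<open>A\<close> can be chosen with or
  without a given \<open>y\<close>. For \<open>S = {0}\<close> the excluded case
  \<open>n = 2 * k\<close> leaves more than \<open>k\<close> elements outside \<open>A\<close>, and
  the choice is made there.\<close>

lemma gen_johnson_graph_two_neighbours:
  assumes k: "0 < k" and S: "S \<subseteq> {0..k - 1}" "S \<noteq> {}"
    and n: "2 * k - Min S \<le> n" "\<not> (S = {0} \<and> n = 2 * k)"
    and A: "A \<subseteq> {1..n}" "card A = k"
  defines "G \<equiv> with_proj (gen_johnson_graph S n k)"
  shows "\<exists>C D. C \<noteq> D \<and> C \<noteq> A \<and> D \<noteq> A \<and> A \<rightarrow>\<^bsub>G\<^esub> C \<and> A \<rightarrow>\<^bsub>G\<^esub> D"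
proof -
  let ?O = "{1..n} - A"
  have finS: "finite S"
    using S(1) finite_subset by blast
  have fin: "finite A" "finite ?O"
    using A finite_subset by auto
  have O: "card ?O = n - k"
    using A fin by (simp add: card_Diff_subset)
  have nk: "2 * k \<le> n + d" if "d \<in> S" for d
    using Min_le[OF finS that] n(1) by linarith
  have adj: "A \<rightarrow>\<^bsub>G\<^esub> (P \<union> Q) \<and> P \<union> Q \<noteq> A" if "d \<in> S" "P \<subseteq> A" "card P = d" "Q \<subseteq> ?O" "card Q = k - d" for d P Q
  proof -
    have "finite P" "finite Q"
      using that fin finite_subset by blast+
    moreover have "P \<inter> Q = {}"
      using that by blast
    moreover have "d < k"
      using that(1) S(1) k by fastforce
    ultimately have "card (P \<union> Q) = k"
      using that by (simp add: card_Un_disjoint)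
    moreover have "A \<inter> (P \<union> Q) = P"
      using that by blast
    moreover have "A \<noteq> P \<union> Q"
      using \<open>A \<inter> (P \<union> Q) = P\<close> \<open>d < k\<close> that(3) A(2) by auto
    moreover have "P \<union> Q \<subseteq> {1..n}"
      using that A by blast
    ultimately show ?thesis
      unfolding G_def gen_johnson_graph_adj_iff using A that by simp
  qed
  show ?thesis
  proof (cases "\<exists>d\<in>S. 1 \<le> d")
    case True
    then obtain d where d: "d \<in> S" "1 \<le> d"
      by blast
    have "d < k"
      using d(1) S(1) k by fastforce
    obtain y where y: "y \<in> A"
      using A(2) k by fastforce
    obtain P where P: "P \<subseteq> A" "card P = d" "y \<in> P"
      using obtain_subset_containing[of A d y] fin(1) A(2) \<open>d < k\<close> d(2) y by auto
    have "d \<le> card (A - {y})"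
      using y fin(1) A(2) \<open>d < k\<close> by simp
    then obtain P' where P': "P' \<subseteq> A - {y}" "card P' = d"
      by (metis obtain_subset_with_card_n)
    have "k - d \<le> card ?O"
      using O nk[OF d(1)] by linarith
    then obtain Q where Q: "Q \<subseteq> ?O" "card Q = k - d"
      by (metis obtain_subset_with_card_n)
    have "P \<union> Q \<noteq> P' \<union> Q"
      using P P' Q y by blast
    moreover have "P' \<subseteq> A"
      using P'(1) by blast
    ultimately show ?thesis
      using adj[OF d(1) P(1,2) Q] adj[OF d(1) _ P'(2) Q]
      by (intro exI[of _ "P \<union> Q"] exI[of _ "P' \<union> Q"]) simp
  next
    case False
    then have "d = 0" if "d \<in> S" for d
      using that by (metis One_nat_def Suc_leI neq0_conv)
    then have S0: "S = {0}"
      using S(2) by blast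
    then have "k < card ?O"
      using n O by simp
    then have "?O \<noteq> {}"
      by (metis card.empty less_nat_zero_code)
    then obtain y where y: "y \<in> ?O"
      by blast
    obtain Q where Q: "Q \<subseteq> ?O" "card Q = k" "y \<in> Q"
      using obtain_subset_containing[of ?O k y] fin(2) \<open>k < card ?O\<close> k y by auto
    have "k \<le> card (?O - {y})"
      using y fin(2) \<open>k < card ?O\<close> by simp
    then obtain Q' where Q': "Q' \<subseteq> ?O - {y}" "card Q' = k"
      by (metis obtain_subset_with_card_n)
    have "Q \<noteq> Q'" "Q' \<subseteq> ?O"
      using Q Q' by blast+
    then show ?thesis
      using adj[of 0 "{}" Q] adj[of 0 "{}" Q'] Q(1,2) Q'(2) S0
      by (intro exI[of _ Q] exI[of _ Q']) simp
  qed
qed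

section \<open>The lower bound\<close>

text \<open>Forces in chronological order: when \<open>v i\<close> forces \<open>w i\<close>, every
  later \<open>w j\<close> is still white, hence neither equal nor adjacent to the black
  \<open>v i\<close>.\<close>

lemma zero_forcing_chain:
  assumes "(force_step G)\<^sup>*\<^sup>* B V" "V = verts G" "finite V" "B \<subseteq> V"
  shows "\<exists>v w. (\<forall>i<card (V - B). v i \<in> V \<and> w i \<in> V \<and> v i \<rightarrow>\<^bsub>G\<^esub> w i) \<and>
               (\<forall>i j. i < j \<longrightarrow> j < card (V - B) \<longrightarrow> v i \<noteq> w j \<and> \<not> v i \<rightarrow>\<^bsub>G\<^esub> w j) \<and>
               w ` {..<card (V - B)} = V - B"
  using assms(1,4)
proof (induction rule: converse_rtranclp_induct)
  case base
  then show ?case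
    by simp
next
  case (step B B')
  obtain x y where xy: "x \<in> B" "{u \<in> verts G - B. x \<rightarrow>\<^bsub>G\<^esub> u} = {y}" "B' = insert y B"
    using step.hyps(1) by (auto simp: force_step_def)
  then have y: "y \<in> V" "y \<notin> B" "x \<rightarrow>\<^bsub>G\<^esub> y"
    using assms(2) by blast+
  have "B' \<subseteq> V"
    using xy y step.prems by auto
  from step.IH[OF this] obtain v w where
      v: "\<forall>i<card (V - B'). v i \<in> V \<and> w i \<in> V \<and> v i \<rightarrow>\<^bsub>G\<^esub> w i"
        "\<forall>i j. i < j \<longrightarrow> j < card (V - B') \<longrightarrow> v i \<noteq> w j \<and> \<not> v i \<rightarrow>\<^bsub>G\<^esub> w j"
    and w: "w ` {..<card (V - B')} = V - B'"
    by blast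
  have VB: "V - B = insert y (V - B')" "y \<notin> V - B'"
    using xy y by auto
  have card: "card (V - B) = Suc (card (V - B'))"
    using assms(3) VB by simp
  have w_new: "x \<noteq> w j \<and> \<not> x \<rightarrow>\<^bsub>G\<^esub> w j" if "j < card (V - B')" for j
  proof -
    have "w j \<in> V - B'"
      using w that by blast
    then show ?thesis
      using xy assms(2) by auto
  qed
  \<comment> \<open>The first force is put in front and the chain of the remaining process is
    shifted by one.\<close>
  define v' where "v' i = (case i of 0 \<Rightarrow> x | Suc i \<Rightarrow> v i)" for i
  define w' where "w' i = (case i of 0 \<Rightarrow> y | Suc i \<Rightarrow> w i)" for i
  have "w' ` {..<card (V - B)} = V - B"
    unfolding card lessThan_Suc_eq_insert_0 using VB(1) w by (simp add: w'_def image_image)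
  moreover have "\<forall>i<card (V - B). v' i \<in> V \<and> w' i \<in> V \<and> v' i \<rightarrow>\<^bsub>G\<^esub> w' i"
    using v(1) xy y step.prems unfolding card v'_def w'_def by (auto split: nat.splits)
  moreover have "\<forall>i j. i < j \<longrightarrow> j < card (V - B) \<longrightarrow> v' i \<noteq> w' j \<and> \<not> v' i \<rightarrow>\<^bsub>G\<^esub> w' j"
    using v(2) w_new unfolding card v'_def w'_def by (auto split: nat.splits)
  ultimately show ?case
    by blast
qed

lemma zero_forcing_set_card_ge:
  assumes k: "0 < k" and s: "s < k" and n: "2 * k - s \<le> n"
    and zf: "zero_forcing_set (with_proj (gen_johnson_graph {s..k - 1} n k)) B"
  shows "(n choose k) - (n - 2 * (k - s) choose s) \<le> card B"
proof -
  let ?G = "with_proj (gen_johnson_graph {s..k - 1} n k)"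
  let ?V = "{A. A \<subseteq> {1..n} \<and> card A = k}"
  have V: "verts ?G = ?V"
    by (simp add: verts_gen_johnson_graph)
  have finV: "finite ?V" and cardV: "card ?V = (n choose k)"
    using n_subsets[of "{1..n}" k] by simp_all
  have BV: "B \<subseteq> ?V" and force: "(force_step ?G)\<^sup>*\<^sup>* B ?V"
    using zf by (simp_all add: zero_forcing_set_def verts_gen_johnson_graph)
  \<comment> \<open>Distinct \<open>k\<close>-sets meet in at most \<open>k - 1\<close> elements, so
    for this \<open>S\<close> adjacency is the threshold condition.\<close>
  have adj: "A \<rightarrow>\<^bsub>?G\<^esub> C \<longleftrightarrow> s \<le> card (A \<inter> C)" if "A \<in> ?V" "C \<in> ?V" "A \<noteq> C" for A C
  proof -
    have fin: "finite A" "finite C"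
      using that finite_subset by blast+
    have "\<not> A \<subseteq> C"
      using card_subset_eq[OF fin(2), of A] that by auto
    then have "card (A \<inter> C) < card A"
      using fin by (intro psubset_card_mono) auto
    then have "card (A \<inter> C) \<le> k - 1"
      using that by auto
    then show ?thesis
      using that unfolding gen_johnson_graph_adj_iff by auto
  qed
  obtain v w where chain: "\<forall>i<card (?V - B). v i \<in> ?V \<and> w i \<in> ?V \<and> v i \<rightarrow>\<^bsub>?G\<^esub> w i"
      "\<forall>i j. i < j \<longrightarrow> j < card (?V - B) \<longrightarrow> v i \<noteq> w j \<and> \<not> v i \<rightarrow>\<^bsub>?G\<^esub> w j"
    using zero_forcing_chain[OF force V[symmetric] finV BV] by (elim exE conjE) (rule that; assumption)
  have "card (?V - B) \<le> (s + (n + s - 2 * k) choose s)"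
  proof (rule skew_threshold_set_pair_bound[where U = "{1..n}" and v = v and w = w and k = k])
    \<comment> \<open>This is \<open>M\<close>; the subtraction is exact because
      \<open>2 * k - s \<le> n\<close>.\<close>
    show "card {1..n} + s = 2 * k + (n + s - 2 * k)"
      using n s by simp
    show "s \<le> card (v i \<inter> w i)" if "i < card (?V - B)" for i
      using chain(1) that unfolding gen_johnson_graph_adj_iff by auto
    show "card (v i \<inter> w j) < s" if "i < j" "j < card (?V - B)" for i j
      using adj[of "v i" "w j"] chain that by (meson less_trans not_le)
  qed (use chain(1) in auto)
  also have "s + (n + s - 2 * k) = n - 2 * (k - s)"
    using n s by simp
  finally have "card (?V - B) \<le> (n - 2 * (k - s) choose s)" .
  moreover have "card (?V - B) = card ?V - card B"
    by (rule card_Diff_subset[OF finite_subset[OF BV finV] BV])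
  ultimately show ?thesis
    using cardV by linarith
qed

section \<open>The upper bound\<close>

lemma connected_zero_forcing_set_exists:
  assumes k: "0 < k" and S: "S \<subseteq> {0..k - 1}" "S \<noteq> {}" and s: "s = Min S"
    and n: "2 * k - s \<le> n" "\<not> (S = {0} \<and> n = 2 * k)"
  defines "G \<equiv> with_proj (gen_johnson_graph S n k)"
  shows "\<exists>B. zero_forcing_set G B \<and> Digraph_Component.connected (G \<restriction> B) \<and>
           card B = (n choose k) - (n - 2 * (k - s) choose s)"
proof -
  have finS: "finite S"
    using S(1) finite_subset by blast
  have "s \<in> S" and s_le: "\<And>d. d \<in> S \<Longrightarrow> s \<le> d"
    using finS S(2) s by auto
  have "s < k"
    using \<open>s \<in> S\<close> S(1) k by fastforce
  define t where "t = k - s"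
  have t: "0 < t" "k = s + t" "s + 2 * t \<le> n"
    using \<open>s < k\<close> n(1) by (auto simp: t_def)
  define X Y R where "X = {1..t}" and "Y = {t + 1..2 * t}" and "R = {2 * t + 1..n}"
  have XYR: "X \<inter> Y = {}" "X \<inter> R = {}" "Y \<inter> R = {}" "X \<subseteq> {1..n}" "Y \<subseteq> {1..n}" "R \<subseteq> {1..n}"
      "card X = t" "card Y = t" "card R = n - 2 * t" "finite X" "finite Y" "finite R"
    using t by (auto simp: X_def Y_def R_def)
  define V where "V = {A. A \<subseteq> {1..n} \<and> card A = k}"
  define \<T> where "\<T> = {T. T \<subseteq> R \<and> card T = s}"
  define W where "W = (\<lambda>T. X \<union> T) ` \<T>"
  define B where "B = V - W"
  have finV: "finite V" and cardV: "card V = (n choose k)"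
    using n_subsets[of "{1..n}" k] by (simp_all add: V_def)
  have card_Un: "card (X \<union> T) = k" "card (Y \<union> T) = k" if "T \<in> \<T>" for T
  proof -
    have "finite T" "X \<inter> T = {}" "Y \<inter> T = {}"
      using that XYR finite_subset unfolding \<T>_def by blast+
    then show "card (X \<union> T) = k" "card (Y \<union> T) = k"
      using that XYR t by (simp_all add: card_Un_disjoint \<T>_def)
  qed
  have WV: "W \<subseteq> V"
    using card_Un XYR by (auto simp: W_def V_def \<T>_def)
  have "inj_on (\<lambda>T. X \<union> T) \<T>"
    using XYR by (auto simp: inj_on_def \<T>_def)
  then have cardW: "card W = (n - 2 * t choose s)"
    using n_subsets[of R s] XYR by (simp add: W_def card_image \<T>_def)
  have "card B = (n choose k) - (n - 2 * t choose s)"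
    using WV finV cardV cardW by (simp add: B_def card_Diff_subset finite_subset)
  obtain y where y: "y \<in> Y"
    using XYR t(1) by fastforce
  have "y \<in> {1..n}"
    using y XYR by blast
  \<comment> \<open>White sets lie in \<open>X \<union> R\<close>, which avoids
    \<open>y\<close>.\<close>
  have star: "A \<in> B" if "A \<subseteq> {1..n}" "card A = k" "y \<in> A" for A
    using that y XYR by (auto simp: B_def V_def W_def \<T>_def)
  \<comment> \<open>The number of white vertices is a binomial coefficient with lower entry 0 in the
    first case and with equal entries in the second.\<close>
  have single: "\<exists>w. w \<subseteq> {1..n} \<and> card w = k \<and> B = {A. A \<subseteq> {1..n} \<and> card A = k} - {w}"
    if "S = {0} \<or> card {1..n} + Min S = 2 * k"
  proof -
    have "s = 0 \<or> n - 2 * t = s"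
      using that s t by auto
    then have "card W = 1"
      using cardW by auto
    then obtain w where "W = {w}"
      using card_1_singletonE by blast
    then show ?thesis
      using WV by (auto simp: B_def V_def)
  qed
  have "zero_forcing_set G B"
  proof (rule zero_forcing_set_if_private_neighbours)
    show "finite (verts G)" "B \<subseteq> verts G"
      using finV by (auto simp: G_def verts_gen_johnson_graph B_def V_def)
    fix w assume "w \<in> verts G - B"
    then have "w \<in> W"
      by (auto simp: G_def verts_gen_johnson_graph B_def V_def)
    then obtain T where T: "T \<in> \<T>" "w = X \<union> T"
      by (auto simp: W_def)
    have YT: "Y \<union> T \<subseteq> {1..n}" "card (Y \<union> T) = k"
      using T card_Un XYR by (auto simp: \<T>_def)
    \<comment> \<open>The intersection with \<open>X \<union> T'\<close> is
      \<open>T \<inter> T'\<close>, of size at most \<open>s\<close>; as \<open>s\<close> is the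
      least element of \<open>S\<close>, adjacency means \<open>T = T'\<close>.\<close>
    have adj: "(Y \<union> T) \<rightarrow>\<^bsub>G\<^esub> u \<longleftrightarrow> u = w" if u: "u \<in> W" for u
    proof -
      obtain T' where T': "T' \<in> \<T>" "u = X \<union> T'"
        using u by (auto simp: W_def)
      have fin: "finite T" "finite T'"
        using T T' XYR finite_subset unfolding \<T>_def by blast+
      have int: "(Y \<union> T) \<inter> (X \<union> T') = T \<inter> T'"
        using T T' XYR unfolding \<T>_def by blast
      have "T \<inter> T' = T \<and> T \<inter> T' = T'" if "s \<le> card (T \<inter> T')"
        using T T' fin that unfolding \<T>_def
        by (metis (mono_tags, lifting) Int_lower1 Int_lower2 card_seteq mem_Collect_eq)
      then have "card (T \<inter> T') \<in> S \<longleftrightarrow> T = T'"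
        using s_le \<open>s \<in> S\<close> T(1) by (auto simp: \<T>_def)
      moreover have "Y \<union> T \<noteq> X \<union> T'"
        using y T' XYR unfolding \<T>_def by blast
      moreover have "u = w \<longleftrightarrow> T = T'"
        using T T' XYR unfolding \<T>_def by blast
      moreover have "u \<subseteq> {1..n}" "card u = k"
        using u WV by (auto simp: V_def)
      ultimately show ?thesis
        using YT T' unfolding G_def gen_johnson_graph_adj_iff by (simp add: int)
    qed
    show "\<exists>v\<in>B. \<forall>u\<in>verts G - B. v \<rightarrow>\<^bsub>G\<^esub> u \<longleftrightarrow> u = w"
    proof
      show "Y \<union> T \<in> B"
        using YT y by (intro star) auto
      show "\<forall>u\<in>verts G - B. (Y \<union> T) \<rightarrow>\<^bsub>G\<^esub> u \<longleftrightarrow> u = w"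
        using adj by (auto simp: G_def verts_gen_johnson_graph B_def V_def)
    qed
  qed
  moreover have "Digraph_Component.connected (G \<restriction> B)"
    unfolding G_def
  proof (rule connected_induce_gen_johnson_graph)
    have "0 < (n - 2 * t choose s)"
      using t by simp
    then obtain T where "T \<in> \<T>"
      using cardW by (fastforce simp: W_def)
    then have "Y \<union> T \<in> B"
      using y card_Un XYR by (intro star) (auto simp: \<T>_def)
    then show "B \<noteq> {}"
      by blast
    show BV: "B \<subseteq> {A. A \<subseteq> {1..n} \<and> card A = k}"
      by (auto simp: B_def V_def)
    show "johnson_link S B A A'" if "A \<in> B" "A' \<in> B" for A A'
      using \<open>y \<in> {1..n}\<close> k S n s star single that BV
      by (intro johnson_link_connected[of "{1..n}" y k S]) simp_all
  qed
  ultimately show ?thesis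
    using \<open>card B = _\<close> unfolding t_def by blast
qed

theorem theorem4p2:
  fixes n k s :: nat and S :: "nat set" and G :: "(nat set, nat set \<times> nat set) pre_digraph"
  assumes "n > 0" and "k > 0"
    and "S \<subseteq> {0..k - 1}" and "S \<noteq> {}"
    and "s = Min S"
    and "n \<ge> 2 * k - s"
    and "\<not> (S = {0} \<and> n = 2 * k)"
    and "G = with_proj (gen_johnson_graph S n k)"
  shows "zero_forcing_number G \<le> total_forcing_number G \<and>
         total_forcing_number G \<le> connected_forcing_number G \<and>
         connected_forcing_number G \<le> enat ((n choose k) - (n - 2 * (k - s) choose s)) \<and>
         (S = {s..k - 1} \<longrightarrow>
           zero_forcing_number G = total_forcing_number G \<and>
           total_forcing_number G = connected_forcing_number G \<and>
           connected_forcing_number G = enat ((n choose k) - (n - 2 * (k - s) choose s)))"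
proof -
  let ?b = "enat ((n choose k) - (n - 2 * (k - s) choose s))"
  interpret pair_graph "gen_johnson_graph S n k"
    by (rule pair_graph_gen_johnson_graph)
  have Z_t: "zero_forcing_number G \<le> total_forcing_number G"
    unfolding zero_forcing_number_def total_forcing_number_def by (rule INF_superset_mono) auto
  \<comment> \<open>Connected zero forcing sets are among those without isolated vertices, so the
    total minimum runs over a larger family.\<close>
  have "no_isolated_vertices (G \<restriction> B)"
    if "zero_forcing_set G B" "Digraph_Component.connected (G \<restriction> B)" for B
  proof (rule no_isolated_vertices_if_connected_zero_forcing[OF _ _ _ that])
    show "wf_digraph G" "symmetric G"
      unfolding assms(8) by (rule wf_digraph_axioms, rule sym_arcs)
    show "\<exists>u w. u \<noteq> w \<and> u \<noteq> v \<and> w \<noteq> v \<and> v \<rightarrow>\<^bsub>G\<^esub> u \<and> v \<rightarrow>\<^bsub>G\<^esub> w" if "v \<in> verts G" for v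
      using that assms unfolding assms(8)
      by (intro gen_johnson_graph_two_neighbours) (auto simp: verts_gen_johnson_graph)
  qed
  then have Z_c: "total_forcing_number G \<le> connected_forcing_number G"
    unfolding total_forcing_number_def connected_forcing_number_def by (intro INF_superset_mono) auto
  obtain B where "zero_forcing_set G B" "Digraph_Component.connected (G \<restriction> B)"
      "enat (card B) = ?b"
    using connected_zero_forcing_set_exists[OF assms(2-7)] unfolding assms(8) by auto
  then have bound: "connected_forcing_number G \<le> ?b"
    unfolding connected_forcing_number_def by (metis (mono_tags, lifting) INF_lower mem_Collect_eq)
  have "?b \<le> zero_forcing_number G" if "S = {s..k - 1}"
  proof -
    have "s < k"
      using assms(2,4) that by auto
    then show ?thesis
      using zero_forcing_set_card_ge[OF assms(2) _ assms(6)] that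
      unfolding zero_forcing_number_def assms(8) by (intro INF_greatest) auto
  qed
  then show ?thesis
    using Z_t Z_c bound by (meson order_antisym order_trans)
qed

end
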